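(* Let $X$ be a $\mu$-symmetric Hunt process on $E$ with semigroup $\{p_t\}_{t>0}$. Assume that $X$ satisfies the following three conditions: I. (Semigroup strong Feller) for any $t>0$, $p_t(\mathcal{B}_b(E))\subset C_b(E)$; II. (Tightness property) $\lim_{x\to\partial}R_1\mathbf{1}_E(x)=0$; III. (Local $L^\infty$-compactness) for any $t>0$ and any open subset $U\subset E$ with $\mu(U)<\infty$, $p_t^U$ is a compact operator on $L^\infty(U,\mu)$. Then, for any $t>0$, $p_t$ is a compact operator on $L^\infty(E,\mu)$.
   Context: $E$ is a locally compact separable metric space, $\mu$ is a positive Radon measure on $E$ with full topological support, and $E_\partial=E\cup\{\partial\}$ is the one-point compactification of $E$; functions $u$ on $E$ are extended to $E_\partial$ by $u(\partial)=0$. $X=(\{X_t\}_{t\ge0},\{P_x\}_{x\in E},\zeta)$ is a $\mu$-symmetric Hunt process on $E$ with life time $\zeta$; $E_x$ is expectation under $P_x$. $\mathcal{B}_b(E)$ is the space of bounded Borel measurable functions on $E$, $C_b(E)$ the space of bounded continuous functions. For $f\in\mathcal{B}_b(E)$, $p_tf(x)=E_x[f(X_t)]=E_x[f(X_t):t<\zeta]$ and $R_\alpha f(x)=E_x[\int_0^\zeta e^{-\alpha t}f(X_t)\,dt]$. By symmetry and the Markov property, $p_t$ and $R_\alpha$ extend canonically to $L^p(E,\mu)$, $1\le p\le\infty$ (same notation). For an open set $U\subset E$, $\tau_U=\inf\{t>0\mid X_t\notin U\}$ ($\inf\emptyset=\infty$), and $p_t^Uf(x)=E_x[f(X_t):t<\tau_U]$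 is the semigroup of the part process of $X$ on $U$, which is symmetric with respect to $\mu|_U$ and likewise extends to $L^p(U,\mu)$, $1\le p\le\infty$. "$\lim_{x\to\partial}g(x)=0$" means: for every $\varepsilon>0$ there is a compact $K\subset E$ with $|g|<\varepsilon$ on $E\setminus K$. *)

theory Defs
  imports "HOL-Probability.Probability"
begin

section \<open>One-point compactification\<close>

text \<open>
  The set $E_\partial$ is the type \<open>'a option\<close>, with \<open>None\<close> in the role of $\partial$.
  If $E$ is already compact, then $\partial$ is an isolated point.
\<close>

definition one_point :: "'a::topological_space option topology" where
  "one_point = topology (\<lambda>U. open (Some -` U) \<and> (None \<in> U \<longrightarrow> compact (- (Some -` U))))"

lemma openin_one_point:
  "openin one_point U \<longleftrightarrow> open (Some -` U) \<and> (None \<in> U \<longrightarrow> compact (- (Some -` U)))"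
proof -
  have "istopology (\<lambda>U::'a option set. open (Some -` U) \<and> (None \<in> U \<longrightarrow> compact (- (Some -` U))))"
    unfolding istopology_def
  proof (intro conjI allI impI; (elim conjE)?)
    fix S T :: "'a option set"
    assume "open (Some -` S)" "open (Some -` T)"
    then show "open (Some -` (S \<inter> T))" by (auto simp: vimage_Int)
  next
    fix S T :: "'a option set"
    assume "None \<in> S \<longrightarrow> compact (- (Some -` S))" "None \<in> T \<longrightarrow> compact (- (Some -` T))"
      and "None \<in> S \<inter> T"
    then show "compact (- (Some -` (S \<inter> T)))" by (auto simp: vimage_Int)
  next
    fix \<K> :: "'a option set set"
    assume "\<forall>K\<in>\<K>. open (Some -` K) \<and> (None \<in> K \<longrightarrow> compact (- (Some -` K)))"
    then show "open (Some -` \<Union>\<K>)" by (auto simp: vimage_Union)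
  next
    fix \<K> :: "'a option set set"
    assume *: "\<forall>K\<in>\<K>. open (Some -` K) \<and> (None \<in> K \<longrightarrow> compact (- (Some -` K)))"
      and "None \<in> \<Union>\<K>"
    then obtain K where K: "K \<in> \<K>" "None \<in> K" by auto
    have "open (Some -` \<Union>\<K>)" using * by (auto simp: vimage_Union)
    then have "compact (- (Some -` K) \<inter> - (Some -` \<Union>\<K>))"
      using * K by (intro compact_Int_closed) auto
    moreover have "- (Some -` K) \<inter> - (Some -` \<Union>\<K>) = - (Some -` \<Union>\<K>)"
      using K by auto
    ultimately show "compact (- (Some -` \<Union>\<K>))" by simp
  qed
  then show ?thesis
    by (simp add: one_point_def topology_inverse')
qed

definition borel_one_point :: "'a::topological_space option measure" where
  "borel_one_point = sigma UNIV {U. openin one_point U}"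

definition extend_zero :: "('a \<Rightarrow> 'b::zero) \<Rightarrow> 'a option \<Rightarrow> 'b" where
  "extend_zero u y = (case y of None \<Rightarrow> 0 | Some x \<Rightarrow> u x)"

definition vanishes_at_boundary :: "('a::topological_space \<Rightarrow> real) \<Rightarrow> bool" where
  "vanishes_at_boundary g \<longleftrightarrow> (\<forall>\<epsilon>>0. \<exists>K. compact K \<and> (\<forall>x\<in>-K. \<bar>g x\<bar> < \<epsilon>))"


section \<open>Radon measures of full support\<close>

definition radon_measure :: "'a::topological_space measure \<Rightarrow> bool" where
  "radon_measure \<mu> \<longleftrightarrow>
     sets \<mu> = sets borel \<and>
     (\<forall>K. compact K \<longrightarrow> emeasure \<mu> K < \<infinity>) \<and>
     (\<forall>B\<in>sets borel. emeasure \<mu> B = (SUP K\<in>{K. compact K \<and> K \<subseteq> B}. emeasure \<mu> K))"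

definition full_support :: "'a::topological_space measure \<Rightarrow> bool" where
  "full_support \<mu> \<longleftrightarrow> (\<forall>U. open U \<longrightarrow> U \<noteq> {} \<longrightarrow> emeasure \<mu> U > 0)"


section \<open>Hunt processes\<close>

text \<open>
  Time is $[0,\infty]$, i.e. the type \<^typ>\<open>ennreal\<close>, so that stopping times may take the value
  $\infty$ and $X_\sigma = \partial$ where $\sigma = \infty$.  The underlying measurable space is that
  of \<open>M\<close> (the measure carried by \<open>M\<close> is never used); the measures $P_x$ are defined on it
  for all $x \in E_\partial$.
\<close>

definition lifetime :: "(ennreal \<Rightarrow> 'w \<Rightarrow> 'a option) \<Rightarrow> 'w \<Rightarrow> ennreal" where
  "lifetime X \<omega> = Inf {t. X t \<omega> = None}"

text \<open>Since $X_\infty = \partial$, the infimum over $t \in (0,\infty]$ realises $\inf\emptyset = \infty$.\<close>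

definition exit_time :: "(ennreal \<Rightarrow> 'w \<Rightarrow> 'a option) \<Rightarrow> 'a set \<Rightarrow> 'w \<Rightarrow> ennreal" where
  "exit_time X U \<omega> = Inf {t. 0 < t \<and> X t \<omega> \<notin> Some ` U}"

locale markov_process =
  fixes M :: "'w measure"
    and F :: "ennreal \<Rightarrow> 'w measure"
    and X :: "ennreal \<Rightarrow> 'w \<Rightarrow> 'a::topological_space option"
    and P :: "'a option \<Rightarrow> 'w measure"
  assumes prob_P: "\<And>x. prob_space (P x)"
    and sets_P: "\<And>x. sets (P x) = sets M"
    and filtration: "filtration (space M) F"
    and subalgebra: "\<And>t. subalgebra M (F t)"
    and adapted: "\<And>t. X t \<in> F t \<rightarrow>\<^sub>M borel_one_point"
    and measurable_P: "\<And>t B. t < \<infinity> \<Longrightarrow> B \<in> sets borel \<Longrightarrow>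
      (\<lambda>x. measure (P (Some x)) {\<omega>\<in>space M. X t \<omega> \<in> Some ` B}) \<in> borel_measurable borel"
    and markov: "\<And>x s t B. s < \<infinity> \<Longrightarrow> t < \<infinity> \<Longrightarrow> B \<in> sets borel_one_point \<Longrightarrow>
      AE \<omega> in P x.
        real_cond_exp (P x) (F t) (indicator {\<omega>\<in>space M. X (t + s) \<omega> \<in> B}) \<omega>
          = measure (P (X t \<omega>)) {\<omega>'\<in>space M. X s \<omega>' \<in> B}"
    and cemetery: "\<And>t. AE \<omega> in P None. X t \<omega> = None"
    and normal: "\<And>x. AE \<omega> in P (Some x). X 0 \<omega> = Some x"

text \<open>
  Strong Markov property and quasi-left-continuity are stated under each $P_x$, $x \in E_\partial$;
  under a general initial law $\nu$, i.e. for $P_\nu = \int P_x\,\nu(dx)$, they follow by integration.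
  In the strong Markov property, $\mathcal{F}_\sigma$ is \<^const>\<open>filtration.pre_sigma\<close>.
\<close>

locale hunt_process = markov_process M F X P
  for M :: "'w measure"
    and F :: "ennreal \<Rightarrow> 'w measure"
    and X :: "ennreal \<Rightarrow> 'w \<Rightarrow> 'a::topological_space option"
    and P :: "'a option \<Rightarrow> 'w measure" +
  assumes X_infinity: "\<And>\<omega>. \<omega> \<in> space M \<Longrightarrow> X \<infinity> \<omega> = None"
    and dead: "\<And>\<omega> t. \<omega> \<in> space M \<Longrightarrow> lifetime X \<omega> \<le> t \<Longrightarrow> X t \<omega> = None"
    and shift: "\<And>t. \<exists>\<theta>. \<theta> \<in> space M \<rightarrow> space M \<and>
      (\<forall>\<omega>\<in>space M. \<forall>s. X s (\<theta> \<omega>) = X (s + t) \<omega>)"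
    and right_continuous: "\<And>\<omega> t. \<omega> \<in> space M \<Longrightarrow> t < \<infinity> \<Longrightarrow>
      limitin one_point (\<lambda>s. X s \<omega>) (X t \<omega>) (at_right t)"
    and left_limits: "\<And>\<omega> t. \<omega> \<in> space M \<Longrightarrow> 0 < t \<Longrightarrow> t < \<infinity> \<Longrightarrow>
      \<exists>y. limitin one_point (\<lambda>s. X s \<omega>) y (at_left t)"
    and filtration_right_continuous: "\<And>t. t < \<infinity> \<Longrightarrow> sets (F t) = (\<Inter>s\<in>{t<..}. sets (F s))"
    and strong_markov: "\<And>x \<sigma> s B. stopping_time F \<sigma> \<Longrightarrow> s < \<infinity> \<Longrightarrow> B \<in> sets borel_one_point \<Longrightarrow>
      AE \<omega> in P x.
        real_cond_exp (P x) (filtration.pre_sigma (space M) F \<sigma>)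
            (indicator {\<omega>\<in>space M. X (\<sigma> \<omega> + s) \<omega> \<in> B}) \<omega>
          = measure (P (X (\<sigma> \<omega>) \<omega>)) {\<omega>'\<in>space M. X s \<omega>' \<in> B}"
    and quasi_left_continuous: "\<And>x (\<sigma> :: nat \<Rightarrow> 'w \<Rightarrow> ennreal).
      (\<And>n. stopping_time F (\<sigma> n)) \<Longrightarrow> (\<And>\<omega>. \<omega> \<in> space M \<Longrightarrow> incseq (\<lambda>n. \<sigma> n \<omega>)) \<Longrightarrow>
      AE \<omega> in P x. (SUP n. \<sigma> n \<omega>) < \<infinity> \<longrightarrow>
        limitin one_point (\<lambda>n. X (\<sigma> n \<omega>) \<omega>) (X (SUP n. \<sigma> n \<omega>) \<omega>) sequentially"

text \<open>$\mu$-symmetry: $(p_t f, g)_\mu = (f, p_t g)_\mu$ for all nonnegative Borel $f$, $g$.\<close>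

definition symmetric_process ::
  "(ennreal \<Rightarrow> 'w \<Rightarrow> 'a::topological_space option) \<Rightarrow> ('a option \<Rightarrow> 'w measure) \<Rightarrow> 'a measure \<Rightarrow> bool"
where
  "symmetric_process X P \<mu> \<longleftrightarrow>
     (\<forall>t>0. \<forall>f\<in>borel_measurable borel. \<forall>g\<in>borel_measurable borel.
        (\<integral>\<^sup>+x. (\<integral>\<^sup>+\<omega>. extend_zero f (X (ennreal t) \<omega>) \<partial>P (Some x)) * g x \<partial>\<mu>)
      = (\<integral>\<^sup>+x. f x * (\<integral>\<^sup>+\<omega>. extend_zero g (X (ennreal t) \<omega>) \<partial>P (Some x)) \<partial>\<mu>))"


section \<open>Semigroup, resolvent and part semigroup\<close>

text \<open>
  Expectations are integrals against the completion of $P_x$: the event $\{t < \tau_U\}$ belongs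
  only to the completed $\sigma$-algebra in general, and a Bochner integral of a non-measurable
  function would be $0$.
\<close>

definition expect :: "('a option \<Rightarrow> 'w measure) \<Rightarrow> 'a \<Rightarrow> ('w \<Rightarrow> real) \<Rightarrow> real" where
  "expect P x Z = (\<integral>\<omega>. Z \<omega> \<partial>completion (P (Some x)))"

definition semigroup_op ::
  "(ennreal \<Rightarrow> 'w \<Rightarrow> 'a option) \<Rightarrow> ('a option \<Rightarrow> 'w measure) \<Rightarrow> real \<Rightarrow> ('a \<Rightarrow> real) \<Rightarrow> 'a \<Rightarrow> real"
where
  "semigroup_op X P t f x = expect P x (\<lambda>\<omega>. extend_zero f (X (ennreal t) \<omega>))"

definition resolvent_op ::
  "(ennreal \<Rightarrow> 'w \<Rightarrow> 'a option) \<Rightarrow> ('a option \<Rightarrow> 'w measure) \<Rightarrow> real \<Rightarrow> ('a \<Rightarrow> real) \<Rightarrow> 'a \<Rightarrow> real"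
where
  "resolvent_op X P \<alpha> f x = expect P x (\<lambda>\<omega>.
     LINT t:{t. 0 \<le> t \<and> ennreal t < lifetime X \<omega>}|lborel.
       exp (- \<alpha> * t) * extend_zero f (X (ennreal t) \<omega>))"

definition part_semigroup_op ::
  "(ennreal \<Rightarrow> 'w \<Rightarrow> 'a option) \<Rightarrow> ('a option \<Rightarrow> 'w measure) \<Rightarrow> 'a set \<Rightarrow> real \<Rightarrow> ('a \<Rightarrow> real) \<Rightarrow> 'a \<Rightarrow> real"
where
  "part_semigroup_op X P U t f x =
     expect P x (\<lambda>\<omega>. indicator {\<omega>. ennreal t < exit_time X U \<omega>} \<omega> * extend_zero f (X (ennreal t) \<omega>))"

definition strong_Feller ::
  "(ennreal \<Rightarrow> 'w \<Rightarrow> 'a::topological_space option) \<Rightarrow> ('a option \<Rightarrow> 'w measure) \<Rightarrow> bool"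
where
  "strong_Feller X P \<longleftrightarrow>
     (\<forall>t>0. \<forall>f\<in>borel_measurable borel. bounded (range f) \<longrightarrow>
        continuous_on UNIV (semigroup_op X P t f) \<and> bounded (range (semigroup_op X P t f)))"


section \<open>$L^\infty$ and its compact operators\<close>

text \<open>
  The elements of \<open>Linf \<nu>\<close> are classes of $\nu$-a.e. equal, essentially bounded measurable
  functions.  For a measure such as \<^term>\<open>restrict_space \<mu> U\<close>, whose space is a proper subset of
  the type, the values of a representative off that space are irrelevant.
\<close>

definition Linf_fun :: "'a measure \<Rightarrow> ('a \<Rightarrow> real) set" where
  "Linf_fun \<nu> = {f \<in> borel_measurable \<nu>. \<exists>C. AE x in \<nu>. \<bar>f x\<bar> \<le> C}"

definition ae_equal :: "'a measure \<Rightarrow> (('a \<Rightarrow> real) \<times> ('a \<Rightarrow> real)) set" where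
  "ae_equal \<nu> = {(f, g). f \<in> Linf_fun \<nu> \<and> g \<in> Linf_fun \<nu> \<and> (AE x in \<nu>. f x = g x)}"

definition Linf :: "'a measure \<Rightarrow> ('a \<Rightarrow> real) set set" where
  "Linf \<nu> = Linf_fun \<nu> // ae_equal \<nu>"

definition ess_norm :: "'a measure \<Rightarrow> ('a \<Rightarrow> real) \<Rightarrow> real" where
  "ess_norm \<nu> f = enn2real (esssup \<nu> (\<lambda>x. ennreal \<bar>f x\<bar>))"

text \<open>
  The values below do not depend on the chosen representatives: see \<open>Linf_norm_eq\<close> and
  \<open>Linf_dist_eq\<close>.
\<close>

definition Linf_norm :: "'a measure \<Rightarrow> ('a \<Rightarrow> real) set \<Rightarrow> real" where
  "Linf_norm \<nu> A = ess_norm \<nu> (SOME f. f \<in> A)"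

definition Linf_dist :: "'a measure \<Rightarrow> ('a \<Rightarrow> real) set \<Rightarrow> ('a \<Rightarrow> real) set \<Rightarrow> real" where
  "Linf_dist \<nu> A B = ess_norm \<nu> (\<lambda>x. (SOME f. f \<in> A) x - (SOME g. g \<in> B) x)"

definition Linf_add :: "'a measure \<Rightarrow> ('a \<Rightarrow> real) set \<Rightarrow> ('a \<Rightarrow> real) set \<Rightarrow> ('a \<Rightarrow> real) set" where
  "Linf_add \<nu> A B = {h \<in> Linf_fun \<nu>. \<exists>f\<in>A. \<exists>g\<in>B. AE x in \<nu>. h x = f x + g x}"

definition Linf_scale :: "'a measure \<Rightarrow> real \<Rightarrow> ('a \<Rightarrow> real) set \<Rightarrow> ('a \<Rightarrow> real) set" where
  "Linf_scale \<nu> c A = {h \<in> Linf_fun \<nu>. \<exists>f\<in>A. AE x in \<nu>. h x = c * f x}"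

definition Linf_topology :: "'a measure \<Rightarrow> ('a \<Rightarrow> real) set topology" where
  "Linf_topology \<nu> = Metric_space.mtopology (Linf \<nu>) (Linf_dist \<nu>)"

definition compact_operator_Linf ::
  "'a measure \<Rightarrow> (('a \<Rightarrow> real) set \<Rightarrow> ('a \<Rightarrow> real) set) \<Rightarrow> bool"
where
  "compact_operator_Linf \<nu> T \<longleftrightarrow>
     T \<in> Linf \<nu> \<rightarrow> Linf \<nu> \<and>
     (\<forall>A\<in>Linf \<nu>. \<forall>B\<in>Linf \<nu>. T (Linf_add \<nu> A B) = Linf_add \<nu> (T A) (T B)) \<and>
     (\<forall>c. \<forall>A\<in>Linf \<nu>. T (Linf_scale \<nu> c A) = Linf_scale \<nu> c (T A)) \<and>
     compactin (Linf_topology \<nu>)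
       (Linf_topology \<nu> closure_of (T ` {A \<in> Linf \<nu>. Linf_norm \<nu> A \<le> 1}))"

text \<open>
  The operator on $L^\infty(\nu)$ induced by an operator \<open>T\<close> on bounded measurable functions: it
  sends the class of \<open>f\<close> to the class of \<open>T f\<close>.  Only bounded representatives are used, since
  $E_x[f(X_t)]$ need not exist for an essentially bounded \<open>f\<close>.
\<close>

definition Linf_extension ::
  "'a measure \<Rightarrow> (('a \<Rightarrow> real) \<Rightarrow> 'a \<Rightarrow> real) \<Rightarrow> ('a \<Rightarrow> real) set \<Rightarrow> ('a \<Rightarrow> real) set"
where
  "Linf_extension \<nu> T A =
     {g \<in> Linf_fun \<nu>. \<exists>f\<in>A. bounded (f ` space \<nu>) \<and> (AE x in \<nu>. g x = T f x)}"

lemma equiv_ae_equal: "equiv (Linf_fun \<nu>) (ae_equal \<nu>)"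
proof (rule equivI)
  show "ae_equal \<nu> \<subseteq> Linf_fun \<nu> \<times> Linf_fun \<nu>" by (auto simp: ae_equal_def)
  show "refl_on (Linf_fun \<nu>) (ae_equal \<nu>)" by (auto simp: ae_equal_def refl_on_def)
  show "sym (ae_equal \<nu>)" by (auto simp: ae_equal_def sym_def elim: eventually_mono)
  show "trans (ae_equal \<nu>)"
  proof (rule transI)
    fix f g h assume "(f, g) \<in> ae_equal \<nu>" "(g, h) \<in> ae_equal \<nu>"
    then show "(f, h) \<in> ae_equal \<nu>" by (auto simp: ae_equal_def)
  qed
qed

lemma Linf_fun_diff:
  assumes "f \<in> Linf_fun \<nu>" "g \<in> Linf_fun \<nu>"
  shows "(\<lambda>x. f x - g x) \<in> Linf_fun \<nu>"
proof -
  obtain C D where "AE x in \<nu>. \<bar>f x\<bar> \<le> C" "AE x in \<nu>. \<bar>g x\<bar> \<le> D"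
    using assms by (auto simp: Linf_fun_def)
  then have "AE x in \<nu>. \<bar>f x - g x\<bar> \<le> C + D" by eventually_elim linarith
  then show ?thesis using assms by (auto simp: Linf_fun_def)
qed

lemma ess_norm_AE:
  assumes "f \<in> Linf_fun \<nu>"
  shows "AE x in \<nu>. \<bar>f x\<bar> \<le> ess_norm \<nu> f"
proof -
  obtain C where C: "AE x in \<nu>. \<bar>f x\<bar> \<le> C" using assms by (auto simp: Linf_fun_def)
  have [measurable]: "f \<in> borel_measurable \<nu>" using assms by (auto simp: Linf_fun_def)
  have "esssup \<nu> (\<lambda>x. ennreal \<bar>f x\<bar>) \<le> ennreal C"
    using C by (intro esssup_I) (auto elim!: eventually_mono intro: ennreal_leI)
  then have fin: "esssup \<nu> (\<lambda>x. ennreal \<bar>f x\<bar>) < top" by (simp add: le_less_trans)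
  have "AE x in \<nu>. ennreal \<bar>f x\<bar> \<le> esssup \<nu> (\<lambda>x. ennreal \<bar>f x\<bar>)" by (rule esssup_AE)
  then show ?thesis
  proof eventually_elim
    case (elim x)
    then show ?case unfolding ess_norm_def using enn2real_mono[OF elim fin] by simp
  qed
qed

lemma ess_norm_le:
  assumes "f \<in> borel_measurable \<nu>" "AE x in \<nu>. \<bar>f x\<bar> \<le> C" "0 \<le> C"
  shows "ess_norm \<nu> f \<le> C"
proof -
  have [measurable]: "f \<in> borel_measurable \<nu>" by fact
  have "esssup \<nu> (\<lambda>x. ennreal \<bar>f x\<bar>) \<le> ennreal C"
    using assms by (intro esssup_I) (auto elim!: eventually_mono intro: ennreal_leI)
  from enn2real_mono[OF this] show ?thesis using assms by (simp add: ess_norm_def)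
qed

lemma ess_norm_nonneg: "0 \<le> ess_norm \<nu> f"
  by (simp add: ess_norm_def)

lemma ess_norm_cong:
  assumes "f \<in> borel_measurable \<nu>" "g \<in> borel_measurable \<nu>" "AE x in \<nu>. f x = g x"
  shows "ess_norm \<nu> f = ess_norm \<nu> g"
proof -
  have [measurable]: "f \<in> borel_measurable \<nu>" "g \<in> borel_measurable \<nu>" by fact+
  have "esssup \<nu> (\<lambda>x. ennreal \<bar>f x\<bar>) = esssup \<nu> (\<lambda>x. ennreal \<bar>g x\<bar>)"
    using assms(3) by (intro esssup_AE_cong) (auto elim: eventually_mono)
  then show ?thesis by (simp add: ess_norm_def)
qed

lemma LinfD:
  assumes "A \<in> Linf \<nu>"
  shows "A \<noteq> {}" "A \<subseteq> Linf_fun \<nu>" "f \<in> A \<Longrightarrow> g \<in> A \<Longrightarrow> AE x in \<nu>. f x = g x"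
    "f \<in> A \<Longrightarrow> g \<in> Linf_fun \<nu> \<Longrightarrow> AE x in \<nu>. f x = g x \<Longrightarrow> g \<in> A"
proof -
  note e = equiv_ae_equal[of \<nu>]
  show "A \<noteq> {}" "A \<subseteq> Linf_fun \<nu>"
    using assms in_quotient_imp_non_empty[OF e] in_quotient_imp_subset[OF e] by (auto simp: Linf_def)
  show "AE x in \<nu>. f x = g x" if "f \<in> A" "g \<in> A"
    using assms that quotient_eq_iff[OF e, of A A f g] by (auto simp: Linf_def ae_equal_def)
  show "g \<in> A" if "f \<in> A" "g \<in> Linf_fun \<nu>" "AE x in \<nu>. f x = g x"
  proof -
    have "f \<in> Linf_fun \<nu>" using that \<open>A \<subseteq> Linf_fun \<nu>\<close> by auto
    then have "(f, g) \<in> ae_equal \<nu>" using that by (auto simp: ae_equal_def)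
    then show ?thesis
      using in_quotient_imp_closed[OF e] assms that by (auto simp: Linf_def)
  qed
qed

lemma Linf_measurable: "A \<in> Linf \<nu> \<Longrightarrow> f \<in> A \<Longrightarrow> f \<in> borel_measurable \<nu>"
  using LinfD(2) by (force simp: Linf_fun_def)

lemma Linf_norm_eq:
  assumes "A \<in> Linf \<nu>" "f \<in> A"
  shows "Linf_norm \<nu> A = ess_norm \<nu> f"
proof -
  have "(SOME f. f \<in> A) \<in> A" using LinfD(1)[OF assms(1)] by (simp add: some_in_eq)
  then show ?thesis
    unfolding Linf_norm_def
    by (intro ess_norm_cong Linf_measurable[OF assms(1)] LinfD(3)[OF assms(1)] assms(2))
qed

lemma Linf_dist_eq:
  assumes "A \<in> Linf \<nu>" "B \<in> Linf \<nu>" "f \<in> A" "g \<in> B"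
  shows "Linf_dist \<nu> A B = ess_norm \<nu> (\<lambda>x. f x - g x)"
proof -
  define f' g' where "f' = (SOME f. f \<in> A)" and "g' = (SOME g. g \<in> B)"
  have in': "f' \<in> A" "g' \<in> B"
    unfolding f'_def g'_def using LinfD(1) assms(1,2) by (auto simp: some_in_eq)
  have "AE x in \<nu>. f' x = f x" "AE x in \<nu>. g' x = g x"
    using LinfD(3)[OF assms(1) in'(1) assms(3)] LinfD(3)[OF assms(2) in'(2) assms(4)] by auto
  then have "AE x in \<nu>. f' x - g' x = f x - g x" by eventually_elim simp
  then have "ess_norm \<nu> (\<lambda>x. f' x - g' x) = ess_norm \<nu> (\<lambda>x. f x - g x)"
    by (intro ess_norm_cong borel_measurable_diff Linf_measurable[OF assms(1)]
        Linf_measurable[OF assms(2)] assms in')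
  then show ?thesis by (simp add: Linf_dist_def f'_def g'_def)
qed

lemma Metric_space_Linf: "Metric_space (Linf \<nu>) (Linf_dist \<nu>)"
proof
  show "0 \<le> Linf_dist \<nu> A B" for A B
    by (simp add: Linf_dist_def ess_norm_nonneg)
  show "Linf_dist \<nu> A B = Linf_dist \<nu> B A" for A B
    by (simp add: Linf_dist_def ess_norm_def abs_minus_commute)
  show "Linf_dist \<nu> A B = 0 \<longleftrightarrow> A = B" if AB: "A \<in> Linf \<nu>" "B \<in> Linf \<nu>" for A B
  proof -
    obtain f g where fg: "f \<in> A" "g \<in> B" using LinfD(1) AB by blast
    then have F: "f \<in> Linf_fun \<nu>" "g \<in> Linf_fun \<nu>" using LinfD(2) AB by blast+
    have "ess_norm \<nu> (\<lambda>x. f x - g x) = 0 \<longleftrightarrow> (AE x in \<nu>. f x = g x)"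
    proof
      assume "ess_norm \<nu> (\<lambda>x. f x - g x) = 0"
      then show "AE x in \<nu>. f x = g x"
        using ess_norm_AE[OF Linf_fun_diff[OF F]] by (auto elim: eventually_mono)
    next
      assume "AE x in \<nu>. f x = g x"
      then have "ess_norm \<nu> (\<lambda>x. f x - g x) \<le> 0"
        using F by (intro ess_norm_le) (auto simp: Linf_fun_def)
      then show "ess_norm \<nu> (\<lambda>x. f x - g x) = 0"
        using ess_norm_nonneg[of \<nu>] by (intro antisym) auto
    qed
    also have "\<dots> \<longleftrightarrow> A = B"
      using quotient_eq_iff[OF equiv_ae_equal, of A \<nu> B f g] AB fg F
      by (auto simp: Linf_def ae_equal_def)
    finally show ?thesis by (simp add: Linf_dist_eq[OF AB fg])
  qed
  show "Linf_dist \<nu> A C \<le> Linf_dist \<nu> A B + Linf_dist \<nu> B C"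
    if ABC: "A \<in> Linf \<nu>" "B \<in> Linf \<nu>" "C \<in> Linf \<nu>" for A B C
  proof -
    obtain f where f: "f \<in> A" using LinfD(1)[OF ABC(1)] by auto
    obtain g where g: "g \<in> B" using LinfD(1)[OF ABC(2)] by auto
    obtain h where h: "h \<in> C" using LinfD(1)[OF ABC(3)] by auto
    have F: "f \<in> Linf_fun \<nu>" "g \<in> Linf_fun \<nu>" "h \<in> Linf_fun \<nu>"
      using LinfD(2)[OF ABC(1)] LinfD(2)[OF ABC(2)] LinfD(2)[OF ABC(3)] f g h by auto
    have "AE x in \<nu>. \<bar>f x - h x\<bar> \<le> ess_norm \<nu> (\<lambda>x. f x - g x) + ess_norm \<nu> (\<lambda>x. g x - h x)"
      using ess_norm_AE[OF Linf_fun_diff[OF F(1,2)]] ess_norm_AE[OF Linf_fun_diff[OF F(2,3)]]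
      by eventually_elim linarith
    then have "ess_norm \<nu> (\<lambda>x. f x - h x)
        \<le> ess_norm \<nu> (\<lambda>x. f x - g x) + ess_norm \<nu> (\<lambda>x. g x - h x)"
      by (intro ess_norm_le add_nonneg_nonneg ess_norm_nonneg borel_measurable_diff)
        (use F in \<open>simp_all add: Linf_fun_def\<close>)
    then show ?thesis
      by (simp only: Linf_dist_eq[OF ABC(1,2) f g] Linf_dist_eq[OF ABC(2,3) g h]
          Linf_dist_eq[OF ABC(1,3) f h])
  qed
qed

end

theory Submission
  imports Defs
begin

text \<open>
  Write $t = 2s$.  The operator $p_t$ is a limit, in operator norm on $L^\infty$, of operators
  $f \mapsto 1_U\, p^U_s(p_s f)$ with $U$ open of finite measure.  Each of these is compact because
  $p^U_s$ is, and compactness survives the limit because $L^\infty$ is complete and total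
  boundedness passes to uniform limits.
  
  For the approximation, fix $\epsilon > 0$.  Since
  $(1 - e^{-u})\,P_y(u < \zeta) \le R_1 1(y)$, tightness yields a compact $K$ with
  $P_y(u < \zeta) \le \epsilon$ for all $y \notin K$ and $u \ge s/2$ (\<open>survival_small\<close>).
  Choose an open $U \supseteq K$ of finite measure and let $\vert f\vert \le 1$.  Off $U$ there is
  nothing to approximate: $\vert p_t f\vert \le P_x(t < \zeta) \le \epsilon$.  On $U$, Chapman-Kolmogorov
  turns the error into $E_x[p_s f(X_s) : \tau_U \le s]$, which is at most
  $P_x(\tau_U \le s,\ t < \zeta)$.  A path that leaves $U$ by time $s$ is outside $K$ at some time
  before $s + s/2$, and from there it has to survive for at least a further $s/2$; so this
  probability is at most $\epsilon$ (\<open>semigroup_part_semigroup_diff_le\<close>).  The point of spending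
  the first half of the time in $p^U$ and the second half in $p$ is exactly to guarantee that
  remaining time: a path may leave $U$ just before $t$ and still be alive at $t$ with large
  probability.
  
  The last step follows from the simple Markov property: by right continuity the
  visit outside $K$ is seen at a time of a countable dense set, and for a finite set of times one
  decomposes according to the first of them at which the path is outside $K$
  (\<open>skeleton_exit_le\<close>).  Quasi-left-continuity enters through measurability.  The event
  $\{s < \tau_U\}$ has to be measurable for the completed law, since otherwise the integral that
  defines $p^U_s$ would be a default value.  For compact sets $K_n$ exhausting $U$ the exit times
  from $K_n$ are stopping times, and $P_x$-almost surely they increase to $\tau_U$ when $x \in U$
  (\<open>AE_exit_time_eq_SUP\<close>).
  
  Symmetry is what makes the operators act on classes: $p_t$ maps indicators of $\mu$-null
  sets to functions vanishing $\mu$-almost everywhere (\<open>AE_avoids_null_set\<close>).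
\<close>

section \<open>The Borel structure of the one-point compactification\<close>

lemma space_borel_one_point [simp]: "space borel_one_point = UNIV"
  by (simp add: borel_one_point_def space_measure_of_conv)

lemma sets_borel_one_point:
  "sets borel_one_point = sigma_sets UNIV {U. openin one_point U}"
  by (simp add: borel_one_point_def)

lemma openin_one_point_in_sets: "openin one_point U \<Longrightarrow> U \<in> sets borel_one_point"
  by (auto simp: sets_borel_one_point)

lemma openin_one_point_Some: "open U \<Longrightarrow> openin one_point (Some ` U)"
  by (auto simp: openin_one_point inj_vimage_image_eq)

lemma openin_one_point_Compl_Some:
  fixes K :: "'a::t2_space set"
  shows "compact K \<Longrightarrow> openin one_point (- Some ` K)"
  by (auto simp: openin_one_point vimage_Compl inj_vimage_image_eq open_Compl compact_imp_closed)

lemma Some_image_in_borel_one_point: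
  assumes "B \<in> sets borel"
  shows "Some ` B \<in> sets borel_one_point"
proof -
  have U: "Some ` UNIV \<in> sets borel_one_point"
    by (intro openin_one_point_in_sets openin_one_point_Some open_UNIV)
  have "B \<in> sigma_sets UNIV {S. open S}"
    using assms by (simp add: borel_def)
  then show ?thesis
  proof induction
    case (Basic S)
    then show ?case by (intro openin_one_point_in_sets openin_one_point_Some) auto
  next
    case (Compl S)
    have "Some ` (UNIV - S) = Some ` UNIV - Some ` S" by auto
    then show ?case using Compl U by auto
  next
    case (Union S)
    have "Some ` (\<Union>i. S i) = (\<Union>i. Some ` S i)" by auto
    then show ?case using Union by auto
  qed simp
qed

lemma None_in_borel_one_point: "{None} \<in> sets borel_one_point"
proof -
  have "y \<in> {None} \<longleftrightarrow> y \<in> UNIV - range Some" for y :: "'a option" by (cases y) auto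
  then have "{None :: 'a option} = UNIV - Some ` UNIV" by blast
  then show ?thesis
    using Some_image_in_borel_one_point[of UNIV] sets.compl_sets[of "Some ` UNIV" borel_one_point]
    by auto
qed

lemma measurable_Some: "Some \<in> borel \<rightarrow>\<^sub>M borel_one_point"
  unfolding borel_one_point_def by (rule measurable_measure_of) (auto simp: openin_one_point)

text \<open>
  A set $A$ is the union of the image of its trace on $E$ and of $A \cap \{\partial\}$, and both are
  Borel; so measurability only has to be tested on $E$.
\<close>

lemma measurable_borel_one_pointI:
  fixes G :: "'a::topological_space option \<Rightarrow> 'b"
  assumes "(\<lambda>x. G (Some x)) \<in> borel \<rightarrow>\<^sub>M N" "G None \<in> space N"
  shows "G \<in> borel_one_point \<rightarrow>\<^sub>M N"
proof (rule measurableI)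
  fix y :: "'a option"
  show "G y \<in> space N" using assms measurable_space[OF assms(1)] by (cases y) auto
next
  fix A assume A: "A \<in> sets N"
  have "G -` A = Some ` ((\<lambda>x. G (Some x)) -` A) \<union> (if G None \<in> A then {None} else {})"
  proof (rule set_eqI)
    fix y show "y \<in> G -` A \<longleftrightarrow> y \<in> Some ` ((\<lambda>x. G (Some x)) -` A) \<union> (if G None \<in> A then {None} else {})"
      by (cases y) auto
  qed
  moreover have "Some ` ((\<lambda>x. G (Some x)) -` A) \<in> sets borel_one_point"
    using measurable_sets[OF assms(1) A] by (intro Some_image_in_borel_one_point) simp
  moreover have "(if G None \<in> A then {None :: 'a option} else {}) \<in> sets borel_one_point"
    by (simp add: None_in_borel_one_point)
  ultimately show "G -` A \<inter> space borel_one_point \<in> sets borel_one_point"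
    by (simp only: space_borel_one_point Int_UNIV_right sets.Un)
qed

lemma extend_zero_simps [simp]: "extend_zero f None = 0" "extend_zero f (Some x) = f x"
  by (simp_all add: extend_zero_def)

lemma measurable_extend_zero:
  fixes f :: "'a::topological_space \<Rightarrow> 'b::{topological_space, zero}"
  shows "f \<in> borel_measurable borel \<Longrightarrow> extend_zero f \<in> borel_one_point \<rightarrow>\<^sub>M borel"
  by (rule measurable_borel_one_pointI) auto

lemma abs_extend_zero_le: "(\<And>x. \<bar>f x\<bar> \<le> C) \<Longrightarrow> 0 \<le> C \<Longrightarrow> \<bar>extend_zero f y\<bar> \<le> (C::real)"
  by (cases y) auto

section \<open>Transition kernels of a Markov process\<close>

context markov_process
begin

lemma space_F [simp]: "space (F t) = space M"
  using filtration by (rule filtration.space_F)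

lemma space_P [simp]: "space (P y) = space M"
  using sets_P by (rule sets_eq_imp_space_eq)

lemma measurable_P_eq: "P y \<rightarrow>\<^sub>M N = M \<rightarrow>\<^sub>M N"
  by (rule measurable_cong_sets) (auto simp: sets_P)

lemma sets_F_mono: "s \<le> t \<Longrightarrow> sets (F s) \<subseteq> sets (F t)"
  using filtration by (rule filtration.sets_F_mono)

lemma sets_F_subset: "sets (F t) \<subseteq> sets M"
  using subalgebra[of t] by (auto simp: subalgebra_def)

lemma measurable_X [measurable]: "X t \<in> M \<rightarrow>\<^sub>M borel_one_point"
  using adapted[of t] sets_F_subset[of t] by (auto simp: measurable_def)

lemma measurable_X_P [measurable]: "X t \<in> P y \<rightarrow>\<^sub>M borel_one_point"
  by (simp add: measurable_P_eq measurable_X)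

lemma event_F:
  assumes "G \<in> sets borel_one_point" "s \<le> t"
  shows "{\<omega>\<in>space M. X s \<omega> \<in> G} \<in> sets (F t)"
  using measurable_sets[OF adapted assms(1), of s] sets_F_mono[OF assms(2)]
  by (auto simp: vimage_def Int_def conj_commute)

lemma event_M:
  assumes "G \<in> sets borel_one_point"
  shows "{\<omega>\<in>space M. X s \<omega> \<in> G} \<in> sets M"
  using event_F[OF assms order_refl] sets_F_subset by blast

lemma markov_event:
  assumes t: "t < \<infinity>" and s: "s < \<infinity>" and A: "A \<in> sets (F t)" and B: "B \<in> sets borel_one_point"
  shows "measure (P y) (A \<inter> {\<omega>\<in>space M. X (t + s) \<omega> \<in> B})
    = (LINT \<omega>:A|P y. real_cond_exp (P y) (F t) (indicator {\<omega>\<in>space M. X (t + s) \<omega> \<in> B}) \<omega>)"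
    and "AE \<omega> in P y.
        real_cond_exp (P y) (F t) (indicator {\<omega>\<in>space M. X (t + s) \<omega> \<in> B}) \<omega>
          = measure (P (X t \<omega>)) {\<omega>'\<in>space M. X s \<omega>' \<in> B}"
proof -
  interpret prob_space "P y" by (rule prob_P)
  interpret finite_measure_subalgebra "P y" "F t"
    by unfold_locales (use subalgebra[of t] in \<open>auto simp: subalgebra_def sets_P\<close>)
  let ?E = "{\<omega>\<in>space M. X (t + s) \<omega> \<in> B}"
  have [measurable]: "?E \<in> sets (P y)" "A \<in> sets (P y)"
    using event_M[OF B] A sets_F_subset by (auto simp: sets_P)
  have "integrable (P y) (indicator ?E :: _ \<Rightarrow> real)" by (auto simp: less_top[symmetric])
  from real_cond_exp_intA[OF this A]
  have "(LINT \<omega>:A|P y. indicator ?E \<omega>)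
    = (LINT \<omega>:A|P y. real_cond_exp (P y) (F t) (indicator ?E) \<omega>)" .
  moreover have "(LINT \<omega>:A|P y. indicator ?E \<omega>) = measure (P y) (A \<inter> ?E)"
    using sets.sets_into_space[OF \<open>A \<in> sets (P y)\<close>]
    by (simp add: set_lebesgue_integral_def indicator_inter_arith[symmetric])
      (intro arg_cong[where f=prob], auto)
  ultimately show "measure (P y) (A \<inter> ?E)
    = (LINT \<omega>:A|P y. real_cond_exp (P y) (F t) (indicator ?E) \<omega>)" by simp
  show "AE \<omega> in P y.
        real_cond_exp (P y) (F t) (indicator {\<omega>\<in>space M. X (t + s) \<omega> \<in> B}) \<omega>
          = measure (P (X t \<omega>)) {\<omega>'\<in>space M. X s \<omega>' \<in> B}"
    by (rule markov[OF s t B])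
qed

text \<open>
  If at time $t$, on an event $A$ of the past, the process sits at points from which $B$ is reached
  after a further time $s$ with probability at most $\epsilon$, then this bound integrates over $A$.
\<close>

lemma markov_event_le:
  assumes t: "t < \<infinity>" and s: "s < \<infinity>" and A: "A \<in> sets (F t)" and B: "B \<in> sets borel_one_point"
    and le: "\<And>\<omega>. \<omega> \<in> A \<Longrightarrow> measure (P (X t \<omega>)) {\<omega>'\<in>space M. X s \<omega>' \<in> B} \<le> \<epsilon>"
  shows "measure (P y) (A \<inter> {\<omega>\<in>space M. X (t + s) \<omega> \<in> B}) \<le> \<epsilon> * measure (P y) A"
proof -
  interpret prob_space "P y" by (rule prob_P)
  interpret finite_measure_subalgebra "P y" "F t"
    by unfold_locales (use subalgebra[of t] in \<open>auto simp: subalgebra_def sets_P\<close>)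
  let ?E = "{\<omega>\<in>space M. X (t + s) \<omega> \<in> B}"
  have [measurable]: "?E \<in> sets (P y)" "A \<in> sets (P y)"
    using event_M[OF B] A sets_F_subset by (auto simp: sets_P)
  have int: "integrable (P y) (real_cond_exp (P y) (F t) (indicator ?E))"
    by (intro real_cond_exp_int(1)) (auto simp: less_top[symmetric])
  have "(LINT \<omega>:A|P y. real_cond_exp (P y) (F t) (indicator ?E) \<omega>) \<le> (LINT \<omega>|P y. \<epsilon> * indicator A \<omega>)"
    unfolding set_lebesgue_integral_def
  proof (rule integral_mono_AE)
    show "integrable (P y) (\<lambda>\<omega>. indicat_real A \<omega> *\<^sub>R real_cond_exp (P y) (F t) (indicator ?E) \<omega>)"
      using integrable_mult_indicator[OF \<open>A \<in> sets (P y)\<close> int] by simp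
    show "AE \<omega> in P y. indicat_real A \<omega> *\<^sub>R real_cond_exp (P y) (F t) (indicator ?E) \<omega> \<le> \<epsilon> * indicat_real A \<omega>"
      using markov_event(2)[OF t s A B, of y] by eventually_elim (auto simp: indicator_def le)
  qed (auto simp: less_top[symmetric])
  also have "\<dots> = \<epsilon> * measure (P y) A"
    using sets.sets_into_space[OF \<open>A \<in> sets (P y)\<close>] by (simp add: Int_absorb2)
  finally show ?thesis by (simp add: markov_event(1)[OF t s A B])
qed

definition kernel :: "ennreal \<Rightarrow> 'a option \<Rightarrow> 'a option measure" where
  "kernel t y = distr (P y) borel_one_point (X t)"

lemma emeasure_kernel:
  "A \<in> sets borel_one_point \<Longrightarrow>
    emeasure (kernel t y) A = ennreal (measure (P y) {\<omega>\<in>space M. X t \<omega> \<in> A})"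
proof -
  interpret prob_space "P y" by (rule prob_P)
  assume "A \<in> sets borel_one_point"
  then show ?thesis
    by (simp add: kernel_def emeasure_distr emeasure_eq_measure vimage_def Int_def conj_commute)
qed

lemma prob_space_kernel: "prob_space (kernel t y)"
  unfolding kernel_def by (intro prob_space.prob_space_distr prob_P) simp

lemma sets_kernel [simp]: "sets (kernel t y) = sets borel_one_point"
  by (simp add: kernel_def)

lemma measurable_kernel:
  assumes t: "t < \<infinity>"
  shows "kernel t \<in> borel_one_point \<rightarrow>\<^sub>M subprob_algebra borel_one_point"
proof (rule measurable_subprob_algebra)
  fix y show "subprob_space (kernel t y)"
    by (intro prob_space_imp_subprob_space prob_space_kernel)
next
  fix A :: "'a option set" assume A: "A \<in> sets borel_one_point"
  define B where "B = Some -` A"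
  have B: "B \<in> sets borel" using measurable_sets[OF measurable_Some A] by (simp add: B_def)
  show "(\<lambda>y. emeasure (kernel t y) A) \<in> borel_measurable borel_one_point"
  proof (rule measurable_borel_one_pointI)
    show "(\<lambda>x. emeasure (kernel t (Some x)) A) \<in> borel_measurable borel"
    proof (cases "None \<in> A")
      case False
      have "y \<in> A \<longleftrightarrow> y \<in> Some ` B" for y using False by (cases y) (auto simp: B_def)
      then have "A = Some ` B" by blast
      then show ?thesis using measurable_P[OF t B] A by (simp add: emeasure_kernel)
    next
      case True
      have "y \<in> A \<longleftrightarrow> y \<in> UNIV - Some ` (- B)" for y using True by (cases y) (auto simp: B_def)
      then have eq: "A = UNIV - Some ` (- B)" by blast
      have "measure (P (Some x)) {\<omega>\<in>space M. X t \<omega> \<in> A}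
        = 1 - measure (P (Some x)) {\<omega>\<in>space M. X t \<omega> \<in> Some ` (- B)}" for x
      proof -
        interpret prob_space "P (Some x)" by (rule prob_P)
        have "{\<omega>\<in>space M. X t \<omega> \<in> A} = space (P (Some x)) - {\<omega>\<in>space M. X t \<omega> \<in> Some ` (- B)}"
          by (auto simp: eq)
        moreover have "{\<omega>\<in>space M. X t \<omega> \<in> Some ` (- B)} \<in> sets (P (Some x))"
          using B by (auto simp: sets_P intro!: event_M Some_image_in_borel_one_point)
        ultimately show ?thesis by (simp only: prob_compl)
      qed
      moreover have "- B \<in> sets borel" using B by auto
      note measurable_P[OF t this]
      ultimately show ?thesis using A by (simp add: emeasure_kernel)
    qed
  qed simp
qed simp

text \<open>
  Chapman-Kolmogorov for kernels: the Markov property, integrated over the whole space.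
\<close>

lemma kernel_add:
  assumes r: "r < \<infinity>" and s: "s < \<infinity>"
  shows "kernel (r + s) y = kernel r y \<bind> kernel s"
proof (rule measure_eqI)
  interpret prob_space "P y" by (rule prob_P)
  have tr: "kernel s \<in> kernel r y \<rightarrow>\<^sub>M subprob_algebra borel_one_point"
    using measurable_kernel[OF s] by (simp cong: measurable_cong_sets)
  have ne: "space (kernel r y) \<noteq> {}" by (rule prob_space.not_empty[OF prob_space_kernel])
  show "sets (kernel (r + s) y) = sets (kernel r y \<bind> kernel s)"
    using sets_bind[of "kernel r y" "kernel s" borel_one_point] ne by simp
  fix A assume "A \<in> sets (kernel (r + s) y)"
  then have A: "A \<in> sets borel_one_point" by simp
  let ?h = "\<lambda>z. measure (P z) {\<omega>'\<in>space M. X s \<omega>' \<in> A}"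
  let ?E = "{\<omega>\<in>space M. X (r + s) \<omega> \<in> A}"
  have Fr: "space M \<in> sets (F r)" using sets.top[of "F r"] by simp
  have E: "?E \<in> sets M" by (rule event_M[OF A])
  have h: "?h \<in> borel_measurable borel_one_point"
    using measurable_compose[OF measurable_kernel[OF s] measurable_emeasure_subprob_algebra[OF A]] 
    by (simp add: emeasure_kernel[OF A])
  have "measure (P y) ?E = measure (P y) (space M \<inter> ?E)" by (intro arg_cong2[of _ _ _ _ measure]) auto
  also have "\<dots> = (LINT \<omega>:space M|P y. real_cond_exp (P y) (F r) (indicator ?E) \<omega>)"
    by (rule markov_event[OF r s Fr A])
  also have "\<dots> = (LINT \<omega>|P y. real_cond_exp (P y) (F r) (indicator ?E) \<omega>)"
    unfolding set_lebesgue_integral_def by (intro Bochner_Integration.integral_cong) auto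
  also have "\<dots> = (LINT \<omega>|P y. ?h (X r \<omega>))"
    using subalgebra[of r] 
    by (intro integral_cong_AE markov_event(2)[OF r s Fr A] measurable_compose[OF measurable_X_P h] measurable_from_subalg[OF _ borel_measurable_cond_exp])
      (auto simp: subalgebra_def sets_P)
  finally have "ennreal (measure (P y) ?E) = (\<integral>\<^sup>+\<omega>. ?h (X r \<omega>) \<partial>P y)"
    by (subst nn_integral_eq_integral)
      (auto intro!: integrable_const_bound[where B=1] measurable_compose[OF measurable_X_P h] prob_space.prob_le_1 prob_P)
  also have "\<dots> = (\<integral>\<^sup>+z. emeasure (kernel s z) A \<partial>kernel r y)"
    unfolding emeasure_kernel[OF A] unfolding kernel_def using h
    by (simp add: nn_integral_distr)
  also have "\<dots> = emeasure (kernel r y \<bind> kernel s) A"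
    by (rule emeasure_bind[OF ne tr A, symmetric])
  finally show "emeasure (kernel (r + s) y) A = emeasure (kernel r y \<bind> kernel s) A"
    by (simp add: emeasure_kernel[OF A])
qed

end

section \<open>Survival probabilities and exit along countably many times\<close>

context markov_process
begin

definition survival :: "ennreal \<Rightarrow> 'a option \<Rightarrow> real" where
  "survival t y = measure (P y) {\<omega>\<in>space M. X t \<omega> \<noteq> None}"

lemma alive_in_sets: "{\<omega>\<in>space M. X t \<omega> \<noteq> None} \<in> sets M"
proof -
  have "- {None} \<in> sets borel_one_point"
    using sets.compl_sets[OF None_in_borel_one_point] by (simp add: Compl_eq_Diff_UNIV)
  from event_M[OF this, of t] show ?thesis by simp
qed

lemma survival_None: "survival t None = 0"
proof -
  have "measure (P None) {\<omega>\<in>space M. X t \<omega> \<noteq> None} = measure (P None) {}"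
    using cemetery[of t] by (intro measure_eq_AE) (auto simp: sets_P alive_in_sets simp del: not_None_eq)
  then show ?thesis by (simp add: survival_def)
qed

lemma survival_nonneg: "0 \<le> survival t y"
  by (simp add: survival_def)

text \<open>
  A path that is seen in $G$ at one of finitely many times and is alive at $t$ has survived for at
  least $s$ after the first such time, which from a point of $G$ has probability at most $\epsilon$.
  The induction adds the latest time $b$ last: the new paths $N$ are those that are in $G$ at $b$
  and at none of the earlier times, an event of the past of $b$.
\<close>

lemma skeleton_exit_le:
  assumes "finite Q" and G: "G \<in> sets borel_one_point" and t: "t < \<infinity>"
    and le: "\<And>y u. y \<in> G \<Longrightarrow> s \<le> u \<Longrightarrow> u < \<infinity> \<Longrightarrow> survival u y \<le> \<epsilon>"
    and Q: "\<And>q. q \<in> Q \<Longrightarrow> q + s \<le> t"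
  shows "measure (P y) ({\<omega>\<in>space M. \<exists>q\<in>Q. X q \<omega> \<in> G} \<inter> {\<omega>\<in>space M. X t \<omega> \<noteq> None})
    \<le> \<epsilon> * measure (P y) {\<omega>\<in>space M. \<exists>q\<in>Q. X q \<omega> \<in> G}"
  using assms(1) Q
proof (induction Q rule: finite_linorder_max_induct)
  case empty
  then show ?case by simp
next
  case (insert b Q)
  interpret prob_space "P y" by (rule prob_P)
  define A where "A = {\<omega>\<in>space M. \<exists>q\<in>Q. X q \<omega> \<in> G}"
  define N where "N = {\<omega>\<in>space M. X b \<omega> \<in> G} - A"
  define D where "D = {\<omega>\<in>space M. X t \<omega> \<noteq> None}"
  have "A = (\<Union>q\<in>Q. {\<omega>\<in>space M. X q \<omega> \<in> G})" by (auto simp: A_def)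
  also have "\<dots> \<in> sets (F b)"
    using insert by (intro sets.finite_UN event_F[OF G]) (auto simp: less_imp_le)
  finally have A: "A \<in> sets (F b)" .
  then have N: "N \<in> sets (F b)"
    unfolding N_def by (intro sets.Diff event_F[OF G]) auto
  have D: "D \<in> sets M" unfolding D_def by (rule alive_in_sets)
  have AND: "A \<in> events" "N \<in> events" "D \<in> events"
    using A N D sets_F_subset by (auto simp: sets_P)
  \<comment> \<open>Splitting off the remaining time as a sum avoids truncated subtraction in \<^typ>\<open>ennreal\<close>.\<close>
  obtain c where "t = b + s + c" using insert.prems[of b] by (auto simp: le_iff_add)
  then have tu: "t = b + (s + c)" by (simp add: add.assoc)
  then have fin: "b < \<infinity>" "s + c < \<infinity>" using t by (auto simp: less_top)
  have G': "- {None} \<in> sets borel_one_point"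
    using sets.compl_sets[OF None_in_borel_one_point] by (simp add: Compl_eq_Diff_UNIV)
  have "prob (N \<inter> {\<omega>\<in>space M. X (b + (s + c)) \<omega> \<in> - {None}}) \<le> \<epsilon> * prob N"
  proof (rule markov_event_le[OF fin N G'])
    fix \<omega> assume "\<omega> \<in> N"
    then show "measure (P (X b \<omega>)) {\<omega>' \<in> space M. X (s + c) \<omega>' \<in> - {None}} \<le> \<epsilon>"
      using le[of "X b \<omega>" "s + c"] fin by (auto simp: N_def survival_def)
  qed
  then have 1: "prob (N \<inter> D) \<le> \<epsilon> * prob N" by (simp add: D_def tu)
  have 2: "prob (A \<inter> D) \<le> \<epsilon> * prob A"
    using insert.IH insert.prems by (simp add: A_def D_def)
  have un: "{\<omega>\<in>space M. \<exists>q\<in>insert b Q. X q \<omega> \<in> G} = A \<union> N" by (auto simp: A_def N_def)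
  have "prob ((A \<union> N) \<inter> D) = prob (A \<inter> D) + prob (N \<inter> D)"
    unfolding Int_Un_distrib2 using AND by (intro finite_measure_Union) (auto simp: N_def)
  moreover have "prob (A \<union> N) = prob A + prob N"
    using AND by (intro finite_measure_Union) (auto simp: N_def)
  ultimately show ?case
    unfolding un D_def[symmetric] using 1 2 by (simp add: distrib_left)
qed

lemma countable_exit_le:
  assumes "countable Q" and G: "G \<in> sets borel_one_point" and t: "t < \<infinity>" and \<epsilon>: "0 \<le> \<epsilon>"
    and le: "\<And>y u. y \<in> G \<Longrightarrow> s \<le> u \<Longrightarrow> u < \<infinity> \<Longrightarrow> survival u y \<le> \<epsilon>"
    and Q: "\<And>q. q \<in> Q \<Longrightarrow> q + s \<le> t"
  shows "measure (P y) ({\<omega>\<in>space M. \<exists>q\<in>Q. X q \<omega> \<in> G} \<inter> {\<omega>\<in>space M. X t \<omega> \<noteq> None}) \<le> \<epsilon>"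
proof (cases "Q = {}")
  case False
  interpret prob_space "P y" by (rule prob_P)
  define A where "A n = {\<omega>\<in>space M. \<exists>q\<in>from_nat_into Q ` {..n}. X q \<omega> \<in> G} \<inter> {\<omega>\<in>space M. X t \<omega> \<noteq> None}"
    for n :: nat
  have le: "prob (A n) \<le> \<epsilon>" for n
  proof -
    have "prob (A n) \<le> \<epsilon> * prob {\<omega>\<in>space M. \<exists>q\<in>from_nat_into Q ` {..n}. X q \<omega> \<in> G}"
      unfolding A_def using False Q
      by (intro skeleton_exit_le[OF _ G t le]) (auto intro: from_nat_into[OF False])
    also have "\<dots> \<le> \<epsilon>" using \<epsilon> by (simp add: mult_left_le)
    finally show ?thesis .
  qed
  have "{\<omega>\<in>space M. \<exists>q\<in>from_nat_into Q ` {..n}. X q \<omega> \<in> G} = (\<Union>q\<in>from_nat_into Q ` {..n}. {\<omega>\<in>space M. X q \<omega> \<in> G})" for n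
    by auto
  then have "A n \<in> events" for n
    unfolding A_def using alive_in_sets event_M[OF G] by (auto simp: sets_P)
  moreover have "incseq A" by (rule incseq_SucI) (force simp: A_def)
  ultimately have "(\<lambda>n. prob (A n)) \<longlonglongrightarrow> prob (\<Union>n. A n)"
    by (intro finite_Lim_measure_incseq) auto
  then have "prob (\<Union>n. A n) \<le> \<epsilon>" by (rule LIMSEQ_le_const2) (use le in auto)
  moreover have "(\<Union>n. A n) = {\<omega>\<in>space M. \<exists>q\<in>Q. X q \<omega> \<in> G} \<inter> {\<omega>\<in>space M. X t \<omega> \<noteq> None}"
  proof -
    have "(\<exists>n. \<exists>q\<in>from_nat_into Q ` {..n}. X q \<omega> \<in> G) \<longleftrightarrow> (\<exists>q\<in>Q. X q \<omega> \<in> G)" for \<omega>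
    proof
      assume "\<exists>q\<in>Q. X q \<omega> \<in> G"
      then obtain q n where "X q \<omega> \<in> G" "q = from_nat_into Q n"
        using from_nat_into_surj[OF assms(1)] by metis
      then show "\<exists>n. \<exists>q\<in>from_nat_into Q ` {..n}. X q \<omega> \<in> G" by auto
    qed (use from_nat_into[OF False] in auto)
    then show ?thesis unfolding A_def by blast
  qed
  ultimately show ?thesis by simp
qed (use \<epsilon> in simp)

section \<open>The semigroup on bounded Borel functions\<close>

lemma expect_eq: "Z \<in> borel_measurable M \<Longrightarrow> expect P x Z = (\<integral>\<omega>. Z \<omega> \<partial>P (Some x))"
  unfolding expect_def by (rule integral_completion) (simp add: measurable_P_eq)

lemma semigroup_op_eq_kernel:
  "f \<in> borel_measurable borel \<Longrightarrow>
    semigroup_op X P t f x = (\<integral>y. extend_zero f y \<partial>kernel (ennreal t) (Some x))"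
  unfolding semigroup_op_def kernel_def
  by (subst expect_eq)
    (auto intro!: integral_distr[symmetric] measurable_compose[OF measurable_X] measurable_extend_zero)

lemma borel_measurable_semigroup_op:
  assumes "f \<in> borel_measurable borel"
  shows "semigroup_op X P t f \<in> borel_measurable borel"
proof -
  have "(\<lambda>x. \<integral>y. extend_zero f y \<partial>kernel (ennreal t) (Some x)) \<in> borel_measurable borel"
    by (rule measurable_compose[OF measurable_Some measurable_compose[OF measurable_kernel
      integral_measurable_subprob_algebra[OF measurable_extend_zero[OF assms]]]]) simp
  then show ?thesis using semigroup_op_eq_kernel[OF assms, of t] by (simp cong: measurable_cong)
qed

text \<open>
  An extended function vanishes at $\partial$, so only the paths alive at time $t$ contribute.
\<close>

lemma integral_kernel_le_survival:
  assumes f: "f \<in> borel_measurable borel" and C: "\<And>x. \<bar>f x\<bar> \<le> C"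
  shows "\<bar>\<integral>y. extend_zero f y \<partial>kernel t z\<bar> \<le> C * survival t z"
proof -
  interpret prob_space "P z" by (rule prob_P)
  have C0: "0 \<le> C" using C[of undefined] by simp
  have [measurable]: "extend_zero f \<in> borel_measurable borel_one_point" by (rule measurable_extend_zero[OF f])
  let ?D = "{\<omega>\<in>space M. X t \<omega> \<noteq> None}"
  have D [measurable]: "?D \<in> sets (P z)" using alive_in_sets by (simp add: sets_P)
  have int: "integrable (P z) (\<lambda>\<omega>. extend_zero f (X t \<omega>))"
    by (rule integrable_const_bound[where B=C]) (use C C0 in \<open>auto simp: abs_extend_zero_le\<close>)
  have "\<bar>\<integral>y. extend_zero f y \<partial>kernel t z\<bar> = \<bar>\<integral>\<omega>. extend_zero f (X t \<omega>) \<partial>P z\<bar>"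
    by (simp add: kernel_def integral_distr)
  also have "\<dots> \<le> (\<integral>\<omega>. \<bar>extend_zero f (X t \<omega>)\<bar> \<partial>P z)" by (rule integral_abs_bound)
  also have "\<dots> \<le> (\<integral>\<omega>. C * indicator ?D \<omega> \<partial>P z)"
  proof (rule integral_mono)
    fix \<omega> assume "\<omega> \<in> space (P z)"
    then show "\<bar>extend_zero f (X t \<omega>)\<bar> \<le> C * indicator ?D \<omega>"
      using C by (cases "X t \<omega>") (auto simp: indicator_def)
  qed (use int in \<open>auto simp: less_top[symmetric] simp del: not_None_eq\<close>)
  also have "\<dots> = C * survival t z"
    using sets.sets_into_space[OF D] by (simp add: survival_def Int_absorb2)
  finally show ?thesis .
qed

lemma abs_semigroup_op_le_survival:
  "f \<in> borel_measurable borel \<Longrightarrow> (\<And>x. \<bar>f x\<bar> \<le> C) \<Longrightarrow>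
    \<bar>semigroup_op X P t f x\<bar> \<le> C * survival (ennreal t) (Some x)"
  using integral_kernel_le_survival[of f C "ennreal t" "Some x"] by (simp add: semigroup_op_eq_kernel)

lemma survival_le_1: "survival t y \<le> 1"
  unfolding survival_def by (intro prob_space.prob_le_1 prob_P)

lemma abs_semigroup_op_le:
  assumes "f \<in> borel_measurable borel" "\<And>x. \<bar>f x\<bar> \<le> C"
  shows "\<bar>semigroup_op X P t f x\<bar> \<le> C"
proof -
  have "0 \<le> C" using assms(2)[of undefined] by simp
  then have "C * survival (ennreal t) (Some x) \<le> C" using survival_le_1 by (simp add: mult_left_le)
  then show ?thesis using abs_semigroup_op_le_survival[OF assms, of t x] by linarith
qed

lemma extend_zero_semigroup_op:
  assumes f: "f \<in> borel_measurable borel" and C: "\<And>x. \<bar>f x\<bar> \<le> C"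
  shows "extend_zero (semigroup_op X P t f) y = (\<integral>z. extend_zero f z \<partial>kernel (ennreal t) y)"
proof (cases y)
  case None
  then show ?thesis
    using integral_kernel_le_survival[OF f C, of "ennreal t" None] by (simp add: survival_None)
qed (simp add: semigroup_op_eq_kernel[OF f])

lemma Chapman_Kolmogorov:
  assumes f: "f \<in> borel_measurable borel" and C: "\<And>x. \<bar>f x\<bar> \<le> C" and r: "0 \<le> r" and s: "0 \<le> s"
  shows "semigroup_op X P (r + s) f x = semigroup_op X P r (semigroup_op X P s f) x"
proof -
  have C0: "0 \<le> C" using C[of undefined] by simp
  have "semigroup_op X P (r + s) f x
    = (\<integral>y. extend_zero f y \<partial>(kernel (ennreal r) (Some x) \<bind> kernel (ennreal s)))"
    using r s by (simp add: semigroup_op_eq_kernel[OF f] ennreal_plus kernel_add)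
  also have "\<dots> = (\<integral>z. (\<integral>y. extend_zero f y \<partial>kernel (ennreal s) z) \<partial>kernel (ennreal r) (Some x))"
  proof (rule integral_bind)
    show "extend_zero f \<in> borel_measurable borel_one_point" by (rule measurable_extend_zero[OF f])
    show "\<bar>extend_zero f y\<bar> \<le> C" for y by (rule abs_extend_zero_le[OF C C0])
    show "kernel (ennreal s) \<in> kernel (ennreal r) (Some x) \<rightarrow>\<^sub>M subprob_algebra borel_one_point"
      using measurable_kernel[of "ennreal s"] by (simp cong: measurable_cong_sets)
    show "finite_measure (kernel (ennreal r) (Some x))"
      using prob_space_kernel by (rule prob_space.axioms)
    show "AE z in kernel (ennreal r) (Some x). emeasure (kernel (ennreal s) z) (space (kernel (ennreal s) z)) \<le> ennreal 1"
      by (simp add: prob_space.emeasure_space_1[OF prob_space_kernel])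
  qed
  also have "\<dots> = semigroup_op X P r (semigroup_op X P s f) x"
    by (simp add: semigroup_op_eq_kernel[OF borel_measurable_semigroup_op[OF f]] extend_zero_semigroup_op[OF f C])
  finally show ?thesis .
qed

text \<open>
  Testing symmetry with $f = 1_N$ and $g = 1$ gives $\int p_t 1_N \,d\mu = \int_N p_t 1 \,d\mu = 0$.
\<close>

lemma AE_avoids_null_set:
  assumes sym: "symmetric_process X P \<mu>" and \<mu>: "sets \<mu> = sets borel" and N: "N \<in> null_sets \<mu>" and t: "0 < t"
  shows "AE x in \<mu>. AE \<omega> in P (Some x). X (ennreal t) \<omega> \<notin> Some ` N"
proof -
  have NB [measurable]: "N \<in> sets borel" using N \<mu> by auto
  have [measurable_cong]: "sets \<mu> = sets borel" by (rule \<mu>)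
  let ?q = "\<lambda>x. \<integral>\<^sup>+\<omega>. extend_zero (indicator N :: _ \<Rightarrow> ennreal) (X (ennreal t) \<omega>) \<partial>P (Some x)"
  have q: "?q x = emeasure (kernel (ennreal t) (Some x)) (Some ` N)" for x
  proof -
    have "extend_zero (indicator N :: _ \<Rightarrow> ennreal) = indicator (Some ` N)"
    proof
      fix y show "extend_zero (indicator N :: _ \<Rightarrow> ennreal) y = indicator (Some ` N) y"
        by (cases y) (auto simp: indicator_def)
    qed
    then have "?q x = (\<integral>\<^sup>+y. indicator (Some ` N) y \<partial>kernel (ennreal t) (Some x))"
      unfolding kernel_def
      by (subst nn_integral_distr)
        (simp_all add: borel_measurable_indicator[OF Some_image_in_borel_one_point[OF NB]])
    then show ?thesis by (simp add: Some_image_in_borel_one_point)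
  qed
  have qm: "?q \<in> borel_measurable \<mu>"
  proof -
    have "(\<lambda>y. emeasure (kernel (ennreal t) y) (Some ` N)) \<in> borel_measurable borel_one_point"
      by (rule measurable_compose[OF measurable_kernel
        measurable_emeasure_subprob_algebra[OF Some_image_in_borel_one_point[OF NB]]]) simp
    from measurable_compose[OF measurable_Some this] show ?thesis
      unfolding q by (simp only: measurable_cong_sets[OF \<mu> refl])
  qed
  have "(\<integral>\<^sup>+x. ?q x * 1 \<partial>\<mu>)
      = (\<integral>\<^sup>+x. indicator N x * (\<integral>\<^sup>+\<omega>. extend_zero (\<lambda>_. 1) (X (ennreal t) \<omega>) \<partial>P (Some x)) \<partial>\<mu>)"
    using sym t unfolding symmetric_process_def by (auto simp del: mult_1_right)
  also have "\<dots> = (\<integral>\<^sup>+x. 0 \<partial>\<mu>)"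
    using AE_not_in[OF N] by (intro nn_integral_cong_AE) (auto elim!: eventually_mono)
  finally have "(\<integral>\<^sup>+x. ?q x \<partial>\<mu>) = 0" by simp
  then have "AE x in \<mu>. ?q x = 0" using qm by (simp add: nn_integral_0_iff_AE)
  then show ?thesis
  proof eventually_elim
    case (elim x)
    then have "AE y in kernel (ennreal t) (Some x). y \<notin> Some ` N"
      unfolding q by (intro AE_not_in) (auto simp: null_sets_def Some_image_in_borel_one_point)
    moreover have "{y. y \<notin> Some ` N} \<in> sets borel_one_point"
      using sets.compl_sets[OF Some_image_in_borel_one_point[OF NB]] by (simp add: set_diff_eq)
    ultimately show ?case unfolding kernel_def by (subst (asm) AE_distr_iff) simp_all
  qed
qed

end

section \<open>Exit times from open sets\<close>

text \<open>
  Every subset of a null set belongs to the completion, so changing a measurable function on a null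
  set keeps it measurable there.
\<close>

lemma measurable_completion_AE:
  fixes f g :: "'a \<Rightarrow> real"
  assumes f: "f \<in> borel_measurable M" and ae: "AE x in M. f x = g x"
  shows "g \<in> borel_measurable (completion M)"
proof (rule measurableI)
  fix A :: "real set" assume A: "A \<in> sets borel"
  have "Measurable.pred (completion M) (\<lambda>x. \<not> f x = g x)"
    using ae by (intro sets_completion_AE) auto
  then have N: "{x \<in> space M. f x \<noteq> g x} \<in> sets (completion M)" by (simp add: pred_def)
  have sub: "B \<in> sets (completion M)" if "B \<subseteq> {x \<in> space M. f x \<noteq> g x}" for B
  proof -
    have "AE x in M. \<not> x \<in> B" using ae that by (auto elim!: eventually_mono)
    from sets_completion_AE[OF this] show ?thesis
      using that by (simp add: pred_def Int_absorb1 subset_iff Collect_conj_eq) 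
  qed
  have "f -` A \<inter> space M \<in> sets (completion M)" using measurable_sets[OF f A] by auto
  moreover have "g -` A \<inter> space (completion M) =
      (f -` A \<inter> space M - {x \<in> space M. f x \<noteq> g x}) \<union> (g -` A \<inter> {x \<in> space M. f x \<noteq> g x})"
    by auto
  ultimately show "g -` A \<inter> space (completion M) \<in> sets (completion M)"
    using N sub[of "g -` A \<inter> {x \<in> space M. f x \<noteq> g x}"] by auto
qed simp

text \<open>
  The state space is metric here so that compact sets are closed, hence complements of compact sets
  are open in $E_\partial$, and so that it has a countable base.
\<close>

locale metric_hunt_process = hunt_process M F X P
  for M :: "'w measure"
    and F :: "ennreal \<Rightarrow> 'w measure"
    and X :: "ennreal \<Rightarrow> 'w \<Rightarrow> 'a::{metric_space, second_countable_topology} option"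
    and P :: "'a option \<Rightarrow> 'w measure"
begin

lemma right_continuous_open:
  assumes "\<omega> \<in> space M" "u < \<infinity>" "openin one_point W" "X u \<omega> \<in> W"
  obtains v where "u < v" "\<And>w. u \<le> w \<Longrightarrow> w < v \<Longrightarrow> X w \<omega> \<in> W"
proof -
  have "eventually (\<lambda>s. X s \<omega> \<in> W) (at_right u)"
    using right_continuous[OF assms(1,2)] assms(3,4) by (auto simp: limitin_def)
  then obtain v where "u < v" "\<And>w. u < w \<Longrightarrow> w < v \<Longrightarrow> X w \<omega> \<in> W"
    using assms(2) by (auto simp: eventually_at_right[of u top])
  with assms(4) that[of v] show ?thesis by (metis order_le_less)
qed

text \<open>
  Being outside a compact set is an open condition in $E_\partial$, so by right continuity it
  persists for a short time and is observed at a time of the dense set $D$.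
\<close>

lemma exit_witness:
  assumes "countable D" "\<And>V :: ennreal set. open V \<Longrightarrow> V \<noteq> {} \<Longrightarrow> \<exists>d\<in>D. d \<in> V"
    and \<omega>: "\<omega> \<in> space M" and K: "compact K" and u: "0 < u" "u < t" "X u \<omega> \<notin> Some ` K"
  shows "\<exists>q\<in>D. 0 < q \<and> q < t \<and> X q \<omega> \<notin> Some ` K"
proof -
  have "u < \<infinity>" using u(2) by (auto simp: less_top[symmetric])
  then obtain v where v: "u < v" "\<And>w. u \<le> w \<Longrightarrow> w < v \<Longrightarrow> X w \<omega> \<in> - Some ` K"
    using right_continuous_open[OF \<omega> _ openin_one_point_Compl_Some[OF K]] u by blast
  have "open {u<..<min v t}" "{u<..<min v t} \<noteq> {}"
    using v u by (auto simp: greaterThanLessThan_empty_iff min_le_iff_disj)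
  then obtain q where "q \<in> D" "u < q" "q < v" "q < t"
    using assms(2)[of "{u<..<min v t}"] by auto
  then show ?thesis using v(2)[of q] u by (intro bexI[of _ q]) auto
qed

lemma exit_time_less_iff: "exit_time X K \<omega> < t \<longleftrightarrow> (\<exists>u>0. u < t \<and> X u \<omega> \<notin> Some ` K)"
  by (auto simp: exit_time_def Inf_less_iff)

lemma exit_time_mono: "K \<subseteq> L \<Longrightarrow> exit_time X K \<omega> \<le> exit_time X L \<omega>"
  unfolding exit_time_def by (intro Inf_superset_mono) auto

text \<open>
  The event $\{\tau_K < t\}$ is a countable union of events $\{X_q \notin K\}$ with $q < t$; the weak
  inequality follows from right continuity of the filtration.
\<close>

lemma stopping_time_exit_time:
  assumes K: "compact K"
  shows "stopping_time F (exit_time X K)"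
proof (rule stopping_timeI)
  obtain D :: "ennreal set"
    where D: "countable D" "\<And>V. open V \<Longrightarrow> V \<noteq> {} \<Longrightarrow> \<exists>d\<in>D. d \<in> V"
    using countable_dense_exists by auto
  have less: "Measurable.pred (F t) (\<lambda>\<omega>. exit_time X K \<omega> < t)" for t
  proof -
    have "{\<omega> \<in> space (F t). exit_time X K \<omega> < t}
      = (\<Union>q\<in>{q\<in>D. 0 < q \<and> q < t}. {\<omega>\<in>space M. X q \<omega> \<in> - Some ` K})"
      using exit_witness[OF D _ K] by (auto simp: exit_time_less_iff) blast
    also have "\<dots> \<in> sets (F t)"
    proof (rule sets.countable_UN'')
      show "countable {q\<in>D. 0 < q \<and> q < t}" using D(1) by simp
      show "{\<omega>\<in>space M. X q \<omega> \<in> - Some ` K} \<in> sets (F t)" if "q \<in> {q\<in>D. 0 < q \<and> q < t}" for q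
        using that by (intro event_F openin_one_point_in_sets openin_one_point_Compl_Some K) auto
    qed
    finally show ?thesis by (simp add: pred_def)
  qed
  show "Measurable.pred (F t) (\<lambda>\<omega>. exit_time X K \<omega> \<le> t)" for t
  proof (cases "t = \<infinity>")
    case True
    then show ?thesis by simp
  next
    case False
    have "Measurable.pred (F s) (\<lambda>\<omega>. exit_time X K \<omega> \<le> t)" if "t < s" for s
    proof -
      have "exit_time X K \<omega> \<le> t \<longleftrightarrow> (\<forall>q\<in>{q\<in>D. t < q \<and> q < s}. exit_time X K \<omega> < q)" for \<omega>
      proof
        assume R: "\<forall>q\<in>{q\<in>D. t < q \<and> q < s}. exit_time X K \<omega> < q"
        show "exit_time X K \<omega> \<le> t"
        proof (rule ccontr)
          assume "\<not> exit_time X K \<omega> \<le> t"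
          then have "open {t<..<min s (exit_time X K \<omega>)}" "{t<..<min s (exit_time X K \<omega>)} \<noteq> {}"
            using that by (auto simp: greaterThanLessThan_empty_iff min_le_iff_disj)
          then obtain q where "q \<in> D" "t < q" "q < s" "q < exit_time X K \<omega>"
            using D(2)[of "{t<..<min s (exit_time X K \<omega>)}"] by auto
          then show False using R by (auto dest: less_asym)
        qed
      qed auto
      moreover have "Measurable.pred (F s) (\<lambda>\<omega>. \<forall>q\<in>{q\<in>D. t < q \<and> q < s}. exit_time X K \<omega> < q)"
      proof -
        let ?D = "{q\<in>D. t < q \<and> q < s}"
        have top: "space M \<in> sets (F s)" using sets.top[of "F s"] by simp
        have "space M - {\<omega>\<in>space M. exit_time X K \<omega> < q} \<in> sets (F s)" if "q \<in> ?D" for q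
        proof (rule sets.Diff[OF top])
          show "{\<omega>\<in>space M. exit_time X K \<omega> < q} \<in> sets (F s)"
            using less[of q] sets_F_mono[of q s] less_imp_le[of q s] that by (auto simp: pred_def)
        qed
        with D(1) have "(\<Union>q\<in>?D. space M - {\<omega>\<in>space M. exit_time X K \<omega> < q}) \<in> sets (F s)"
          by (intro sets.countable_UN'') simp_all
        from sets.Diff[OF top this]
        have "space M - (\<Union>q\<in>?D. space M - {\<omega>\<in>space M. exit_time X K \<omega> < q}) \<in> sets (F s)" .
        also have "space M - (\<Union>q\<in>{q\<in>D. t < q \<and> q < s}. space M - {\<omega>\<in>space M. exit_time X K \<omega> < q})
          = {\<omega>\<in>space M. \<forall>q\<in>{q\<in>D. t < q \<and> q < s}. exit_time X K \<omega> < q}" by auto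
        finally show ?thesis by (simp add: pred_def)
      qed
      ultimately show ?thesis by simp
    qed
    then have "{\<omega>\<in>space M. exit_time X K \<omega> \<le> t} \<in> (\<Inter>s\<in>{t<..}. sets (F s))"
      by (auto simp: pred_def)
    then show ?thesis
      using filtration_right_continuous[of t] False by (simp add: pred_def less_top)
  qed
qed

text \<open>
  If the path were in the interior of $K$ at time $\tau_K$, right continuity would keep it in $K$ for
  a further positive time.
\<close>

lemma exit_position:
  assumes \<omega>: "\<omega> \<in> space M" and fin: "exit_time X K \<omega> < \<infinity>"
  shows "X (exit_time X K \<omega>) \<omega> \<notin> Some ` interior K"
proof
  let ?e = "exit_time X K \<omega>"
  assume *: "X ?e \<omega> \<in> Some ` interior K"
  obtain v where v: "?e < v" "\<And>w. ?e \<le> w \<Longrightarrow> w < v \<Longrightarrow> X w \<omega> \<in> Some ` interior K"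
    using right_continuous_open[OF \<omega> fin openin_one_point_Some[OF open_interior] *] by blast
  then obtain u where u: "0 < u" "u < v" "X u \<omega> \<notin> Some ` K" by (auto simp: exit_time_less_iff)
  then have "?e \<le> u" unfolding exit_time_def by (intro Inf_lower) auto
  then show False using v(2)[of u] u interior_subset[of K] by auto
qed

text \<open>
  Let $\sigma$ be the limit of the exit times $\sigma_n$ from $K_n$; clearly $\sigma \le \tau_U$.
  If $\sigma < \infty$, then $X_{\sigma_n} \to X_\sigma$ by quasi-left-continuity.  Were $X_\sigma$ in
  $U$, it would lie in the interior of some $K_m$, and so would $X_{\sigma_n}$ for large $n \ge m$,
  which \<open>exit_position\<close> forbids.  So $X_\sigma \notin U$.  The exit time is an infimum over strictly
  positive times, so $\tau_U \le \sigma$ also needs $\sigma > 0$; this is where the starting point has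
  to lie in $U$.
\<close>

lemma AE_exit_time_eq_SUP:
  assumes K: "\<And>n. compact (K n)" "incseq K" and U: "U = (\<Union>n. K n)" "U = (\<Union>n. interior (K n))"
    and x: "x \<in> U"
  shows "AE \<omega> in P (Some x). exit_time X U \<omega> = (SUP n. exit_time X (K n) \<omega>)"
proof -
  let ?\<sigma> = "\<lambda>n \<omega>. exit_time X (K n) \<omega>"
  have Kmono: "m \<le> n \<Longrightarrow> K m \<subseteq> K n" for m n using K(2) by (rule incseqD)
  have "AE \<omega> in P (Some x). (SUP n. ?\<sigma> n \<omega>) < \<infinity> \<longrightarrow>
        limitin one_point (\<lambda>n. X (?\<sigma> n \<omega>) \<omega>) (X (SUP n. ?\<sigma> n \<omega>) \<omega>) sequentially"
    by (rule quasi_left_continuous[OF stopping_time_exit_time[OF K(1)]])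
      (auto intro!: incseq_SucI exit_time_mono Kmono)
  moreover have "AE \<omega> in P (Some x). \<omega> \<in> space M"
    using AE_space[of "P (Some x)"] by simp
  ultimately show ?thesis using normal[of x]
  proof eventually_elim
    case (elim \<omega>)
    let ?s = "SUP n. ?\<sigma> n \<omega>"
    have le: "?s \<le> exit_time X U \<omega>" by (intro SUP_least exit_time_mono) (auto simp: U(1))
    have "exit_time X U \<omega> \<le> ?s"
    proof (cases "?s = \<infinity>")
      case False
      then have fin: "?s < \<infinity>" unfolding infinity_ennreal_def top.not_eq_extremum .
      have fin': "?\<sigma> n \<omega> < \<infinity>" for n
        using SUP_upper[of n UNIV "\<lambda>n. ?\<sigma> n \<omega>"] fin by (meson UNIV_I le_less_trans)
      have out: "X ?s \<omega> \<notin> Some ` U"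
      proof
        assume "X ?s \<omega> \<in> Some ` U"
        then obtain m where "X ?s \<omega> \<in> Some ` interior (K m)" by (auto simp: U(2))
        then have "\<forall>\<^sub>F n in sequentially. X (?\<sigma> n \<omega>) \<omega> \<in> Some ` interior (K m)"
          using elim(1) fin openin_one_point_Some[OF open_interior] by (auto simp: limitin_def)
        then have "\<forall>\<^sub>F n in sequentially. False"
          using eventually_ge_at_top[of m]
        proof eventually_elim
          case (elim n)
          then have "X (?\<sigma> n \<omega>) \<omega> \<in> Some ` interior (K n)"
            using interior_mono[OF Kmono[of m n]] by auto
          then show ?case using exit_position[OF \<open>\<omega> \<in> space M\<close> fin', of n] by simp
        qed
        then show False by simp
      qed
      obtain m where m: "x \<in> interior (K m)" using x by (auto simp: U(2))
      have "?\<sigma> m \<omega> \<noteq> 0"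
        using exit_position[OF \<open>\<omega> \<in> space M\<close> fin', of m] elim(3) m by auto
      then have "0 < ?\<sigma> m \<omega>" by (simp add: zero_less_iff_neq_zero)
      also have "\<dots> \<le> ?s" by (rule SUP_upper) simp
      finally have "0 < ?s" .
      with out show ?thesis unfolding exit_time_def[of X U] by (intro Inf_lower) auto
    qed (simp only: infinity_ennreal_def top_greatest)
    with le show ?case by (rule antisym[rotated])
  qed
qed

text \<open>
  Replacing $\tau_U$ by the supremum of the exit times from the $K_n$ changes the integrand on a null
  set only and makes it measurable with respect to the uncompleted $\sigma$-algebra; moreover the
  event $\{t < \tau_U\}$ becomes an event of $\mathcal{F}_t$, to which the Markov property applies.
\<close>

lemma part_semigroup_op_eq:
  assumes K: "\<And>n. compact (K n)" "incseq K" and U: "U = (\<Union>n. K n)" "U = (\<Union>n. interior (K n))"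
    and x: "x \<in> U" and f: "f \<in> borel_measurable borel"
  shows "part_semigroup_op X P U t f x
    = (\<integral>\<omega>. indicator {\<omega>. ennreal t < (SUP n. exit_time X (K n) \<omega>)} \<omega> * extend_zero f (X (ennreal t) \<omega>) \<partial>P (Some x))"
    and "{\<omega>\<in>space M. ennreal t < (SUP n. exit_time X (K n) \<omega>)} \<in> sets (F (ennreal t))"
    and "(\<lambda>\<omega>. indicator {\<omega>. ennreal t < (SUP n. exit_time X (K n) \<omega>)} \<omega> * extend_zero f (X (ennreal t) \<omega>))
      \<in> borel_measurable (P (Some x))"
proof -
  let ?S = "{\<omega>. ennreal t < (SUP n. exit_time X (K n) \<omega>)}"
  let ?f = "\<lambda>\<omega>. extend_zero f (X (ennreal t) \<omega>)"
  have "Measurable.pred (F (ennreal t)) (\<lambda>\<omega>. \<exists>n. ennreal t < exit_time X (K n) \<omega>)"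
    by (intro pred_intros_countable stopping_timeD2 stopping_time_exit_time K)
  then show S: "{\<omega>\<in>space M. ennreal t < (SUP n. exit_time X (K n) \<omega>)} \<in> sets (F (ennreal t))"
    by (simp add: pred_def less_SUP_iff)
  have fm: "?f \<in> borel_measurable M"
    by (rule measurable_compose[OF measurable_X measurable_extend_zero[OF f]])
  have "(\<lambda>\<omega>. indicator {\<omega>\<in>space M. \<omega> \<in> ?S} \<omega> * ?f \<omega>) \<in> borel_measurable M"
    using S sets_F_subset by (intro borel_measurable_times fm borel_measurable_indicator) auto
  then have m: "(\<lambda>\<omega>. indicator ?S \<omega> * ?f \<omega>) \<in> borel_measurable (P (Some x))"
    unfolding measurable_P_eq by (rule measurable_cong[THEN iffD1, rotated]) (auto simp: indicator_def)
  then show "(\<lambda>\<omega>. indicator ?S \<omega> * ?f \<omega>) \<in> borel_measurable (P (Some x))" .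
  have ae: "AE \<omega> in P (Some x). indicator ?S \<omega> * ?f \<omega> = indicator {\<omega>. ennreal t < exit_time X U \<omega>} \<omega> * ?f \<omega>"
    using AE_exit_time_eq_SUP[OF K U x] by eventually_elim (simp add: indicator_def)
  have "part_semigroup_op X P U t f x = (\<integral>\<omega>. indicator ?S \<omega> * ?f \<omega> \<partial>completion (P (Some x)))"
    unfolding part_semigroup_op_def expect_def
    by (rule integral_cong_AE) (use m ae in \<open>auto intro: measurable_completion measurable_completion_AE AE_completion elim: eventually_mono\<close>)
  also have "\<dots> = (\<integral>\<omega>. indicator ?S \<omega> * ?f \<omega> \<partial>P (Some x))" by (rule integral_completion[OF m])
  finally show "part_semigroup_op X P U t f x = (\<integral>\<omega>. indicator ?S \<omega> * ?f \<omega> \<partial>P (Some x))" .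
qed

end

section \<open>Exhaustion by compact sets\<close>

lemma compact_inside_open:
  fixes U :: "'a::{metric_space, second_countable_topology} set"
  assumes "locally compact (UNIV :: 'a set)" "open U" "x \<in> U"
  obtains V L where "open V" "compact L" "x \<in> V" "V \<subseteq> L" "L \<subseteq> U"
  using assms unfolding locally_def by (metis UNIV_I open_openin subtopology_UNIV)

text \<open>
  By the Lindelof property $U$ is covered by countably many open sets that lie in compact subsets of
  $U$; take finite unions of the latter.
\<close>

lemma compact_exhaustion:
  fixes U :: "'a::{metric_space, second_countable_topology} set"
  assumes lc: "locally compact (UNIV :: 'a set)" and U: "open U"
  obtains K :: "nat \<Rightarrow> 'a set" where "\<And>n. compact (K n)" "incseq K" "U = (\<Union>n. K n)" "U = (\<Union>n. interior (K n))"
proof -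
  have "\<exists>V L. open V \<and> compact L \<and> x \<in> V \<and> V \<subseteq> L \<and> L \<subseteq> U" if "x \<in> U" for x
    using compact_inside_open[OF lc U that] by metis
  then obtain V L where VL: "\<And>x. x \<in> U \<Longrightarrow> open (V x) \<and> compact (L x) \<and> x \<in> V x \<and> V x \<subseteq> L x \<and> L x \<subseteq> U"
    by metis
  obtain \<F> where \<F>: "\<F> \<subseteq> V ` U" "countable \<F>" "\<Union>\<F> = \<Union>(V ` U)"
    using Lindelof[of "V ` U"] VL by blast
  obtain C where C: "C \<subseteq> U" "countable C" "\<F> = V ` C"
    using countable_subset_image[of \<F> V U] \<F> by auto
  have cover: "U \<subseteq> (\<Union>x\<in>C. V x)" using VL \<F>(3) C(3) by blast
  show ?thesis
  proof (cases "C = {}")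
    case True
    then show ?thesis using cover that[of "\<lambda>_. {}"] by (auto simp: incseq_def)
  next
    case False
    define K where "K n = (\<Union>x\<in>from_nat_into C ` {..n}. L x)" for n
    have CU: "from_nat_into C n \<in> U" for n using from_nat_into[OF False] C(1) by blast
    show ?thesis
    proof (rule that)
      show "compact (K n)" for n unfolding K_def using VL CU by (intro compact_UN) auto
      show "incseq K" by (intro monoI, unfold K_def, intro UN_mono image_mono) auto
      have int: "V (from_nat_into C n) \<subseteq> interior (K n)" for n
        using VL[OF CU[of n]] by (intro interior_maximal) (auto simp: K_def)
      have 1: "U \<subseteq> (\<Union>n. interior (K n))"
      proof
        fix x assume "x \<in> U"
        then obtain c where "c \<in> C" "x \<in> V c" using cover by auto
        then obtain n where "x \<in> V (from_nat_into C n)" using from_nat_into_surj[OF C(2)] by metis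
        then show "x \<in> (\<Union>n. interior (K n))" using int[of n] by auto
      qed
      have "L (from_nat_into C n) \<subseteq> U" for n using VL[OF CU[of n]] by simp
      then have 2: "(\<Union>n. K n) \<subseteq> U" by (auto simp: K_def)
      have 3: "(\<Union>n. interior (K n)) \<subseteq> (\<Union>n. K n)" by (intro UN_mono interior_subset order_refl)
      show "U = (\<Union>n. K n)" "U = (\<Union>n. interior (K n))" using 1 2 3 by blast+
    qed
  qed
qed

lemma compact_subset_finite_open:
  fixes K :: "'a::{metric_space, second_countable_topology} set"
  assumes lc: "locally compact (UNIV :: 'a set)" and K: "compact K" and \<mu>: "radon_measure \<mu>"
  obtains U where "open U" "K \<subseteq> U" "emeasure \<mu> U < \<infinity>"
proof -
  obtain L where L: "\<And>n. compact (L n)" "incseq L" "UNIV = (\<Union>n. interior (L n :: 'a set))"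
    using compact_exhaustion[OF lc open_UNIV] by metis
  obtain N where N: "finite N" "K \<subseteq> (\<Union>n\<in>N. interior (L n))"
    using compactE_image[OF K, of UNIV "\<lambda>n. interior (L n)"] L(3) by (metis open_interior top_greatest)
  have c: "compact (\<Union>n\<in>N. L n)" using N L by (intro compact_UN) auto
  have "emeasure \<mu> (\<Union>n\<in>N. interior (L n)) \<le> emeasure \<mu> (\<Union>n\<in>N. L n)"
    using interior_subset c \<mu> by (intro emeasure_mono) (auto simp: radon_measure_def intro: borel_compact)
  also have "\<dots> < \<infinity>" using c \<mu> by (simp add: radon_measure_def)
  finally show ?thesis using that[of "\<Union>n\<in>N. interior (L n)"] N by auto
qed

section \<open>Tightness and survival\<close>

text \<open>
  For $z = \zeta(\omega)$ these are the facts about $\int_0^\zeta e^{-t}\,dt$, the integrand of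
  $R_1 1$: it is at most $1$, and at least $1 - e^{-s}$ when the path is alive at time $s$.
\<close>

lemma integral_exp_upto:
  shows "integrable lborel (\<lambda>t. indicator {t. 0 \<le> t \<and> ennreal t < z} t * exp (- t :: real))" (is ?A)
    and "(\<integral>t. indicator {t. 0 \<le> t \<and> ennreal t < z} t * exp (- t) \<partial>lborel) \<le> 1" (is ?B)
    and "0 \<le> s \<Longrightarrow> ennreal s < z \<Longrightarrow> 1 - exp (- s) \<le> (\<integral>t. indicator {t. 0 \<le> t \<and> ennreal t < z} t * exp (- t) \<partial>lborel)" (is "_ \<Longrightarrow> _ \<Longrightarrow> ?C")
proof -
  have lim: "((\<lambda>t::real. - exp (- t)) \<longlongrightarrow> 0) at_top"
    using tendsto_minus[OF filterlim_compose[OF exp_at_bot filterlim_uminus_at_bot_at_top]] by simp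
  have nn: "(\<integral>\<^sup>+t. ennreal (exp (- t)) * indicator {0..} t \<partial>lborel) = ennreal (0 - (- exp (- 0)))"
    by (rule nn_integral_FTC_atLeast[where F="\<lambda>t. - exp (- t)"])
      (auto intro!: derivative_eq_intros lim)
  have i0: "integrable lborel (\<lambda>t. indicator {0..} t * exp (- t :: real))"
    using nn by (intro integrableI_nonneg) (auto simp: ennreal_mult' ennreal_indicator mult.commute)
  have v0: "(\<integral>t. indicator {0..} t * exp (- t) \<partial>lborel) = (1::real)"
    using nn by (subst integral_eq_nn_integral) (auto simp: ennreal_mult' ennreal_indicator mult.commute)
  have set: "{t::real. 0 \<le> t \<and> ennreal t < z} \<in> sets borel" by measurable
  show ?A
    using integrable_mult_indicator[OF _ i0, of "{t. 0 \<le> t \<and> ennreal t < z}"] set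
    by (rule_tac Bochner_Integration.integrable_bound) (auto simp: indicator_def)
  have "(\<integral>t. indicator {t. 0 \<le> t \<and> ennreal t < z} t * exp (- t) \<partial>lborel) \<le> (\<integral>t. indicator {0..} t * exp (- t) \<partial>lborel)"
    by (rule integral_mono[OF \<open>?A\<close> i0]) (auto simp: indicator_def)
  then show ?B using v0 by simp
  assume s: "0 \<le> s" "ennreal s < z"
  have "(\<integral>t. exp (- t) * indicator {0..s} t \<partial>lborel) = - exp (- s) - (- exp (- 0))"
    using s by (intro integral_FTC_Icc_real) (auto intro!: derivative_eq_intros continuous_intros)
  then have "1 - exp (- s) = (\<integral>t. indicator {0..s} t * exp (- t) \<partial>lborel)" by (simp add: mult.commute)
  also have "\<dots> \<le> (\<integral>t. indicator {t. 0 \<le> t \<and> ennreal t < z} t * exp (- t) \<partial>lborel)"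
  proof (rule integral_mono)
    show "integrable lborel (\<lambda>t. indicator {0..s} t * exp (- t))"
      by (rule Bochner_Integration.integrable_bound[OF i0]) (auto simp: indicator_def)
    fix t show "indicator {0..s} t * exp (- t) \<le> indicator {t. 0 \<le> t \<and> ennreal t < z} t * exp (- t)"
      using s le_less_trans[OF ennreal_leI, of t s z] by (auto simp: indicator_def)
  qed fact
  finally show ?C .
qed

context metric_hunt_process
begin

text \<open>
  The path stays at $\partial$ after its lifetime, so being dead can be read off from one time; this
  makes the lifetime measurable.
\<close>

lemma lifetime_le_iff: "\<omega> \<in> space M \<Longrightarrow> lifetime X \<omega> \<le> t \<longleftrightarrow> X t \<omega> = None"
  using dead[of \<omega> t] by (auto simp: lifetime_def intro: Inf_lower)

lemma measurable_lifetime [measurable]: "lifetime X \<in> borel_measurable M"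
proof (rule borel_measurableI_le)
  fix t
  have "{\<omega>\<in>space M. lifetime X \<omega> \<le> t} = {\<omega>\<in>space M. X t \<omega> \<in> {None}}"
    using lifetime_le_iff by auto
  then show "{\<omega>\<in>space M. lifetime X \<omega> \<le> t} \<in> sets M"
    using event_M[OF None_in_borel_one_point] by simp
qed

lemma survival_le_resolvent:
  assumes s: "0 \<le> s"
  shows "(1 - exp (- s)) * survival (ennreal s) (Some y) \<le> resolvent_op X P 1 (\<lambda>_. 1) y"
proof -
  interpret prob_space "P (Some y)" by (rule prob_P)
  define J where "J \<omega> = (\<integral>t. indicator {t. 0 \<le> t \<and> ennreal t < lifetime X \<omega>} t * exp (- t) \<partial>lborel)" for \<omega>
  have J: "J \<in> borel_measurable M"
    unfolding J_def by measurable
  have J1: "J \<omega> \<le> 1" for \<omega>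
    unfolding J_def by (rule integral_exp_upto(2))
  have J0: "0 \<le> J \<omega>" for \<omega> unfolding J_def by (intro integral_nonneg_AE) auto
  have eq: "(LINT t:{t. 0 \<le> t \<and> ennreal t < lifetime X \<omega>}|lborel. exp (- 1 * t) * extend_zero (\<lambda>_. 1) (X (ennreal t) \<omega>)) = J \<omega>"
    if "\<omega> \<in> space M" for \<omega>
    unfolding J_def set_lebesgue_integral_def
  proof (rule Bochner_Integration.integral_cong[OF refl])
    fix t
    have "X (ennreal t) \<omega> \<noteq> None" if "ennreal t < lifetime X \<omega>"
      using that lifetime_le_iff[OF \<open>\<omega> \<in> space M\<close>, of "ennreal t"] by auto
    then show "indicator {t. 0 \<le> t \<and> ennreal t < lifetime X \<omega>} t *\<^sub>R (exp (- 1 * t) * extend_zero (\<lambda>_. 1) (X (ennreal t) \<omega>))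
      = indicator {t. 0 \<le> t \<and> ennreal t < lifetime X \<omega>} t * exp (- t)"
      by (auto simp: indicator_def)
  qed
  have "resolvent_op X P 1 (\<lambda>_. 1) y = (\<integral>\<omega>. J \<omega> \<partial>completion (P (Some y)))"
    unfolding resolvent_op_def expect_def by (rule Bochner_Integration.integral_cong) (use eq in auto)
  also have "\<dots> = (\<integral>\<omega>. J \<omega> \<partial>P (Some y))"
    by (rule integral_completion) (use J in \<open>simp add: measurable_P_eq\<close>)
  also have "(\<integral>\<omega>. (1 - exp (- s)) * indicator {\<omega>\<in>space M. X (ennreal s) \<omega> \<noteq> None} \<omega> \<partial>P (Some y)) \<le> \<dots>"
  proof (rule integral_mono)
    show "integrable (P (Some y)) J"
      using J J0 J1 by (intro integrable_const_bound[where B=1]) (auto simp: measurable_P_eq)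
    show "integrable (P (Some y)) (\<lambda>\<omega>. (1 - exp (- s)) * indicator {\<omega>\<in>space M. X (ennreal s) \<omega> \<noteq> None} \<omega>)"
      using alive_in_sets by (auto simp: less_top[symmetric] sets_P simp del: not_None_eq)
    fix \<omega> assume "\<omega> \<in> space (P (Some y))"
    then show "(1 - exp (- s)) * indicator {\<omega>\<in>space M. X (ennreal s) \<omega> \<noteq> None} \<omega> \<le> J \<omega>"
      using integral_exp_upto(3)[of s "lifetime X \<omega>"] s J0[of \<omega>] lifetime_le_iff[of \<omega> "ennreal s"]
      by (auto simp: indicator_def J_def not_le simp del: not_None_eq)
  qed
  finally show ?thesis
    by (simp add: survival_def Collect_conj_eq Int_ac del: not_None_eq)
qed

text \<open>
  The bound is uniform in $u \ge s$ because $1 - e^{-u} \ge 1 - e^{-s}$.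
\<close>

lemma survival_small:
  assumes van: "vanishes_at_boundary (resolvent_op X P 1 (\<lambda>_. 1))" and s: "0 < s" and \<epsilon>: "0 < \<epsilon>"
  obtains K where "compact K" "\<And>y u. y \<notin> Some ` K \<Longrightarrow> ennreal s \<le> u \<Longrightarrow> u < \<infinity> \<Longrightarrow> survival u y \<le> \<epsilon>"
proof -
  have e: "0 < 1 - exp (- s)" using s by simp
  then obtain K where K: "compact K" "\<And>x. x \<in> - K \<Longrightarrow> \<bar>resolvent_op X P 1 (\<lambda>_. 1) x\<bar> < (1 - exp (- s)) * \<epsilon>"
    using van \<epsilon> unfolding vanishes_at_boundary_def by (meson mult_pos_pos)
  show ?thesis
  proof (rule that[OF K(1)])
    fix y u assume y: "y \<notin> Some ` K" and u: "ennreal s \<le> u" "u < \<infinity>"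
    show "survival u y \<le> \<epsilon>"
    proof (cases y)
      case None
      then show ?thesis using \<epsilon> by (simp add: survival_None)
    next
      case (Some x)
      \<comment> \<open>The estimate by the resolvent is for real times.\<close>
      define v where "v = enn2real u"
      have uv: "u = ennreal v" using u by (simp add: v_def)
      have v: "s \<le> v" using u s by (simp add: uv) (metis ennreal_le_iff2 not_le less_le_trans)
      have "(1 - exp (- s)) * survival u y \<le> (1 - exp (- v)) * survival u y"
        using v by (intro mult_right_mono survival_nonneg) simp
      also have "\<dots> \<le> resolvent_op X P 1 (\<lambda>_. 1) x"
        using survival_le_resolvent[of v x] v s by (simp add: Some uv)
      also have "\<dots> \<le> (1 - exp (- s)) * \<epsilon>" 
      proof -
        have "x \<in> - K" using y unfolding Some by auto
        from K(2)[OF this] show ?thesis by linarith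
      qed
      finally show ?thesis using e by simp
    qed
  qed
qed

text \<open>
  By Chapman-Kolmogorov both terms are expectations of $p_s f(X_r)$, the second one restricted to
  $\{r < \tau_U\}$.  The difference lives on $\{\tau_U \le r\}$ and, since $\vert p_s f\vert$ is at most
  the probability of surviving for a time $s$, is bounded by $P_x(\tau_U \le r,\ r + s < \zeta)$.
  Leaving $U$ by time $r$ means being outside $K$ at some time $q < r + s/2$ of a countable dense set,
  and then a time of at least $s/2$ remains to be survived from a point outside $K$.
\<close>

lemma semigroup_part_semigroup_diff_le:
  assumes lc: "locally compact (UNIV :: 'a set)" and U: "open U" and K: "compact K" "K \<subseteq> U"
    and r: "0 < r" and s: "0 < s" and \<epsilon>: "0 \<le> \<epsilon>"
    and small: "\<And>y u. y \<notin> Some ` K \<Longrightarrow> ennreal (s / 2) \<le> u \<Longrightarrow> u < \<infinity> \<Longrightarrow> survival u y \<le> \<epsilon>"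
    and f: "f \<in> borel_measurable borel" and f1: "\<And>x. \<bar>f x\<bar> \<le> 1" and x: "x \<in> U"
  shows "\<bar>semigroup_op X P (r + s) f x - part_semigroup_op X P U r (semigroup_op X P s f) x\<bar> \<le> \<epsilon>"
proof -
  interpret prob_space "P (Some x)" by (rule prob_P)
  let ?P = "P (Some x)"
  obtain L where L: "\<And>n. compact (L n)" "incseq L" "U = (\<Union>n. L n)" "U = (\<Union>n. interior (L n))"
    using compact_exhaustion[OF lc U] by metis
  define \<sigma> where "\<sigma> \<omega> = (SUP n. exit_time X (L n) \<omega>)" for \<omega>
  define g where "g = semigroup_op X P s f"
  have g: "g \<in> borel_measurable borel" unfolding g_def by (rule borel_measurable_semigroup_op[OF f])
  have g1: "\<bar>g y\<bar> \<le> 1" for y unfolding g_def by (rule abs_semigroup_op_le[OF f f1])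
  let ?G = "\<lambda>\<omega>. extend_zero g (X (ennreal r) \<omega>)"
  have Gm [measurable]: "?G \<in> borel_measurable ?P"
    by (rule measurable_compose[OF measurable_X_P measurable_extend_zero[OF g]])
  \<comment> \<open>Up to a null set this is the event that the path leaves $U$ by time $r$.\<close>
  define \<Lambda> where "\<Lambda> = {\<omega>\<in>space M. \<sigma> \<omega> \<le> ennreal r}"
  have "{\<omega>\<in>space M. ennreal r < \<sigma> \<omega>} \<in> sets (F (ennreal r))"
    unfolding \<sigma>_def by (rule part_semigroup_op_eq(2)[OF L x f])
  from sets.Diff[OF sets.top this] have \<Lambda>F: "\<Lambda> \<in> sets (F (ennreal r))"
    by (rule back_subst[of "\<lambda>A. A \<in> _"]) (auto simp: \<Lambda>_def)
  then have \<Lambda> [measurable]: "\<Lambda> \<in> events" using sets_F_subset by (auto simp: sets_P)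
  have part: "part_semigroup_op X P U r g x = (\<integral>\<omega>. indicator {\<omega>. ennreal r < \<sigma> \<omega>} \<omega> * ?G \<omega> \<partial>?P)"
    unfolding \<sigma>_def by (rule part_semigroup_op_eq(1)[OF L x g])
  have iG: "integrable ?P ?G"
    by (rule integrable_const_bound[where B=1]) (use g1 in \<open>auto simp: abs_extend_zero_le\<close>)
  have i\<Lambda>: "integrable ?P (\<lambda>\<omega>. indicator \<Lambda> \<omega> * ?G \<omega>)"
    using integrable_mult_indicator[OF \<Lambda> iG] by simp
  have "semigroup_op X P (r + s) f x = semigroup_op X P r g x"
    unfolding g_def using r s by (intro Chapman_Kolmogorov[OF f f1]) auto
  also have "\<dots> = (\<integral>\<omega>. ?G \<omega> \<partial>?P)"
    unfolding semigroup_op_def by (rule expect_eq) (use Gm in \<open>simp add: measurable_P_eq\<close>)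
  finally have "semigroup_op X P (r + s) f x = (\<integral>\<omega>. ?G \<omega> \<partial>?P)" .
  moreover have "part_semigroup_op X P U r g x = (\<integral>\<omega>. ?G \<omega> - indicator \<Lambda> \<omega> * ?G \<omega> \<partial>?P)"
    unfolding part by (rule Bochner_Integration.integral_cong) (auto simp: \<Lambda>_def indicator_def)
  ultimately have "semigroup_op X P (r + s) f x - part_semigroup_op X P U r g x = (\<integral>\<omega>. indicator \<Lambda> \<omega> * ?G \<omega> \<partial>?P)"
    using iG i\<Lambda> by simp
  also have "\<bar>\<dots>\<bar> \<le> (\<integral>\<omega>. \<bar>indicator \<Lambda> \<omega> * ?G \<omega>\<bar> \<partial>?P)" by (rule integral_abs_bound)
  also have "\<dots> \<le> measure ?P (\<Lambda> \<inter> {\<omega>\<in>space M. X (ennreal r + ennreal s) \<omega> \<in> - {None}})"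
  proof -
    interpret finite_measure_subalgebra ?P "F (ennreal r)"
      by unfold_locales (use subalgebra[of "ennreal r"] in \<open>auto simp: subalgebra_def sets_P\<close>)
    have B: "- {None} \<in> sets borel_one_point"
      using sets.compl_sets[OF None_in_borel_one_point] by (simp add: Compl_eq_Diff_UNIV)
    have fin: "ennreal r < \<infinity>" "ennreal s < \<infinity>" by auto
    let ?c = "real_cond_exp ?P (F (ennreal r)) (indicator {\<omega>\<in>space M. X (ennreal r + ennreal s) \<omega> \<in> - {None}})"
    have ic: "integrable ?P ?c"
      using event_M[OF B] by (intro real_cond_exp_int(1)) (auto simp: less_top[symmetric] sets_P simp del: not_None_eq)
    have "AE \<omega> in ?P. \<bar>indicator \<Lambda> \<omega> * ?G \<omega>\<bar> \<le> indicator \<Lambda> \<omega> *\<^sub>R ?c \<omega>"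
      using markov_event(2)[OF fin \<Lambda>F B, of "Some x"]
    proof eventually_elim
      case (elim \<omega>)
      have "\<bar>?G \<omega>\<bar> \<le> survival (ennreal s) (X (ennreal r) \<omega>)"
        unfolding g_def extend_zero_semigroup_op[OF f f1]
        using integral_kernel_le_survival[OF f f1, of "ennreal s" "X (ennreal r) \<omega>"] by simp
      then show ?case using elim by (auto simp: indicator_def survival_def abs_mult)
    qed
    then have "(\<integral>\<omega>. \<bar>indicator \<Lambda> \<omega> * ?G \<omega>\<bar> \<partial>?P) \<le> (\<integral>\<omega>. indicator \<Lambda> \<omega> *\<^sub>R ?c \<omega> \<partial>?P)"
      by (intro integral_mono_AE integrable_abs i\<Lambda> integrable_mult_indicator \<Lambda> ic)
    also have "\<dots> = measure ?P (\<Lambda> \<inter> {\<omega>\<in>space M. X (ennreal r + ennreal s) \<omega> \<in> - {None}})"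
      unfolding markov_event(1)[OF fin \<Lambda>F B] set_lebesgue_integral_def ..
    finally show ?thesis .
  qed
  also have "\<dots> \<le> \<epsilon>"
  proof -
    obtain D :: "ennreal set"
      where D: "countable D" "\<And>V. open V \<Longrightarrow> V \<noteq> {} \<Longrightarrow> \<exists>d\<in>D. d \<in> V"
      using countable_dense_exists by auto
    define Q where "Q = {q\<in>D. 0 < q \<and> q < ennreal (r + s / 2)}"
    have Q: "countable Q" using D(1) by (simp add: Q_def)
    let ?W = "{\<omega>\<in>space M. \<exists>q\<in>Q. X q \<omega> \<in> - Some ` K} \<inter> {\<omega>\<in>space M. X (ennreal (r + s)) \<omega> \<noteq> None}"
    have G: "- Some ` K \<in> sets borel_one_point"
      by (intro openin_one_point_in_sets openin_one_point_Compl_Some K)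
    have "prob ?W \<le> \<epsilon>"
    proof (rule countable_exit_le[OF Q G _ \<epsilon>, where s="ennreal (s / 2)"])
      fix q assume "q \<in> Q"
      then have "q + ennreal (s / 2) \<le> ennreal (r + s / 2) + ennreal (s / 2)"
        by (intro add_right_mono) (auto simp: Q_def)
      also have "\<dots> = ennreal (r + s)" using r s by (simp flip: ennreal_plus)
      finally show "q + ennreal (s / 2) \<le> ennreal (r + s)" .
    qed (use small in auto)
    moreover have "prob (\<Lambda> \<inter> {\<omega>\<in>space M. X (ennreal r + ennreal s) \<omega> \<in> - {None}}) \<le> prob ?W"
    proof (rule finite_measure_mono_AE)
      show "AE \<omega> in ?P. \<omega> \<in> \<Lambda> \<inter> {\<omega>\<in>space M. X (ennreal r + ennreal s) \<omega> \<in> - {None}} \<longrightarrow> \<omega> \<in> ?W"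
        using AE_exit_time_eq_SUP[OF L x]
      proof eventually_elim
        case (elim \<omega>)
        show ?case
        proof
          assume *: "\<omega> \<in> \<Lambda> \<inter> {\<omega>\<in>space M. X (ennreal r + ennreal s) \<omega> \<in> - {None}}"
          then have "exit_time X U \<omega> \<le> ennreal r" using elim by (simp add: \<Lambda>_def \<sigma>_def)
          also have "\<dots> < ennreal (r + s / 2)" using r s by (simp add: ennreal_less_iff)
          finally obtain u where "0 < u" "u < ennreal (r + s / 2)" "X u \<omega> \<notin> Some ` U"
            by (auto simp: exit_time_less_iff)
          then have "\<exists>q\<in>D. 0 < q \<and> q < ennreal (r + s / 2) \<and> X q \<omega> \<notin> Some ` K"
            using * K(2) by (intro exit_witness[OF D _ K(1)]) auto
          then show "\<omega> \<in> ?W" using * r s by (auto simp: Q_def simp flip: ennreal_plus)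
        qed
      qed
      have "{\<omega>\<in>space M. \<exists>q\<in>Q. X q \<omega> \<in> - Some ` K} = (\<Union>q\<in>Q. {\<omega>\<in>space M. X q \<omega> \<in> - Some ` K})" by auto
      also have "\<dots> \<in> sets M" using Q event_M[OF G] by (intro sets.countable_UN'')
      finally show "?W \<in> events" unfolding sets_P using alive_in_sets by (rule sets.Int)
    qed
    ultimately show ?thesis by simp
  qed
  finally show ?thesis by (simp add: g_def)
qed

end

section \<open>The Banach space $L^\infty$\<close>

definition Linf_class :: "'a measure \<Rightarrow> ('a \<Rightarrow> real) \<Rightarrow> ('a \<Rightarrow> real) set" where
  "Linf_class \<nu> f = ae_equal \<nu> `` {f}"

lemma mem_Linf_class:
  "f \<in> Linf_fun \<nu> \<Longrightarrow> g \<in> Linf_class \<nu> f \<longleftrightarrow> g \<in> Linf_fun \<nu> \<and> (AE x in \<nu>. g x = f x)"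
  by (auto simp: Linf_class_def ae_equal_def elim: eventually_mono)

lemma Linf_class_in_Linf: "f \<in> Linf_fun \<nu> \<Longrightarrow> Linf_class \<nu> f \<in> Linf \<nu>"
  by (simp add: Linf_class_def Linf_def quotientI)

lemma Linf_class_self: "f \<in> Linf_fun \<nu> \<Longrightarrow> f \<in> Linf_class \<nu> f"
  by (simp add: mem_Linf_class)

lemma Linf_eq_class:
  assumes "A \<in> Linf \<nu>" "f \<in> A"
  shows "A = Linf_class \<nu> f"
proof -
  have "f \<in> Linf_fun \<nu>" using LinfD(2)[OF assms(1)] assms(2) by auto
  note f = mem_Linf_class[OF this]
  show ?thesis
  proof (intro set_eqI iffI)
    fix h assume "h \<in> A"
    then show "h \<in> Linf_class \<nu> f"
      unfolding f using LinfD(2)[OF assms(1)] LinfD(3)[OF assms(1) _ assms(2)] by blast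
  next
    fix h assume "h \<in> Linf_class \<nu> f"
    then have h: "h \<in> Linf_fun \<nu>" "AE x in \<nu>. h x = f x" by (auto simp: f)
    from h(2) have "AE x in \<nu>. f x = h x" by eventually_elim simp
    from LinfD(4)[OF assms h(1) this] show "h \<in> A" .
  qed
qed

lemma Linf_funI:
  "f \<in> borel_measurable \<nu> \<Longrightarrow> (\<And>x. x \<in> space \<nu> \<Longrightarrow> \<bar>f x\<bar> \<le> C) \<Longrightarrow> f \<in> Linf_fun \<nu>"
  unfolding Linf_fun_def by (auto intro!: exI[of _ C] AE_I2)

lemma Linf_fun_add:
  assumes "f \<in> Linf_fun \<nu>" "g \<in> Linf_fun \<nu>"
  shows "(\<lambda>x. f x + g x) \<in> Linf_fun \<nu>"
proof -
  obtain C D where "AE x in \<nu>. \<bar>f x\<bar> \<le> C" "AE x in \<nu>. \<bar>g x\<bar> \<le> D"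
    using assms by (auto simp: Linf_fun_def)
  then have "AE x in \<nu>. \<bar>f x + g x\<bar> \<le> C + D" by eventually_elim linarith
  then show ?thesis using assms by (auto simp: Linf_fun_def)
qed

lemma Linf_fun_scale:
  assumes "f \<in> Linf_fun \<nu>"
  shows "(\<lambda>x. c * f x) \<in> Linf_fun \<nu>"
proof -
  obtain C where "AE x in \<nu>. \<bar>f x\<bar> \<le> C" using assms by (auto simp: Linf_fun_def)
  then have "AE x in \<nu>. \<bar>c * f x\<bar> \<le> \<bar>c\<bar> * C" by eventually_elim (simp add: abs_mult mult_left_mono)
  then show ?thesis using assms by (auto simp: Linf_fun_def)
qed

lemma Linf_add_class:
  assumes f: "f \<in> Linf_fun \<nu>" and g: "g \<in> Linf_fun \<nu>"
  shows "Linf_add \<nu> (Linf_class \<nu> f) (Linf_class \<nu> g) = Linf_class \<nu> (\<lambda>x. f x + g x)"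
proof (intro set_eqI iffI)
  fix h assume "h \<in> Linf_add \<nu> (Linf_class \<nu> f) (Linf_class \<nu> g)"
  then obtain f' g' where h: "h \<in> Linf_fun \<nu>" "AE x in \<nu>. f' x = f x" "AE x in \<nu>. g' x = g x"
      "AE x in \<nu>. h x = f' x + g' x"
    using f g by (auto simp: Linf_add_def mem_Linf_class)
  from h(2-4) have "AE x in \<nu>. h x = f x + g x" by eventually_elim simp
  then show "h \<in> Linf_class \<nu> (\<lambda>x. f x + g x)" using h f g by (simp add: mem_Linf_class Linf_fun_add)
next
  fix h assume "h \<in> Linf_class \<nu> (\<lambda>x. f x + g x)"
  then show "h \<in> Linf_add \<nu> (Linf_class \<nu> f) (Linf_class \<nu> g)"
    using f g Linf_class_self[OF f] Linf_class_self[OF g]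
    by (auto simp: Linf_add_def mem_Linf_class[OF Linf_fun_add[OF f g]])
qed

lemma Linf_scale_class:
  assumes f: "f \<in> Linf_fun \<nu>"
  shows "Linf_scale \<nu> c (Linf_class \<nu> f) = Linf_class \<nu> (\<lambda>x. c * f x)"
proof (intro set_eqI iffI)
  fix h assume "h \<in> Linf_scale \<nu> c (Linf_class \<nu> f)"
  then obtain f' where h: "h \<in> Linf_fun \<nu>" "AE x in \<nu>. f' x = f x" "AE x in \<nu>. h x = c * f' x"
    using f by (auto simp: Linf_scale_def mem_Linf_class)
  from h(2,3) have "AE x in \<nu>. h x = c * f x" by eventually_elim simp
  then show "h \<in> Linf_class \<nu> (\<lambda>x. c * f x)" using h f by (simp add: mem_Linf_class Linf_fun_scale)
next
  fix h assume "h \<in> Linf_class \<nu> (\<lambda>x. c * f x)"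
  then show "h \<in> Linf_scale \<nu> c (Linf_class \<nu> f)"
    using f Linf_class_self[OF f]
    by (auto simp: Linf_scale_def mem_Linf_class[OF Linf_fun_scale[OF f]])
qed

text \<open>
  Set a representative to zero where it exceeds the norm.
\<close>

lemma Linf_bounded_representative:
  assumes A: "A \<in> Linf \<nu>"
  obtains f where "f \<in> A" "f \<in> borel_measurable \<nu>" "\<And>x. \<bar>f x\<bar> \<le> Linf_norm \<nu> A"
proof -
  obtain g where g: "g \<in> A" using LinfD(1)[OF A] by auto
  then have gL: "g \<in> Linf_fun \<nu>" using LinfD(2)[OF A] by auto
  then have [measurable]: "g \<in> borel_measurable \<nu>" by (simp add: Linf_fun_def)
  let ?C = "Linf_norm \<nu> A"
  have C: "?C = ess_norm \<nu> g" by (rule Linf_norm_eq[OF A g])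
  define f where "f x = (if \<bar>g x\<bar> \<le> ?C then g x else 0)" for x
  have m: "f \<in> borel_measurable \<nu>" unfolding f_def by measurable
  have b: "\<bar>f x\<bar> \<le> ?C" for x using ess_norm_nonneg[of \<nu> g] C by (auto simp: f_def)
  have "AE x in \<nu>. g x = f x"
    using ess_norm_AE[OF gL] by eventually_elim (auto simp: f_def C)
  then have "f \<in> A" using LinfD(4)[OF A g Linf_funI[OF m b]] by simp
  then show ?thesis using that m b by blast
qed

lemma Linf_dist_AE:
  assumes "A \<in> Linf \<nu>" "B \<in> Linf \<nu>" "f \<in> A" "g \<in> B"
  shows "AE x in \<nu>. \<bar>f x - g x\<bar> \<le> Linf_dist \<nu> A B"
  unfolding Linf_dist_eq[OF assms]
  by (rule ess_norm_AE[OF Linf_fun_diff]) (use LinfD(2) assms in blast)+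

lemma Linf_dist_le:
  assumes "A \<in> Linf \<nu>" "B \<in> Linf \<nu>" "f \<in> A" "g \<in> B" "AE x in \<nu>. \<bar>f x - g x\<bar> \<le> C" "0 \<le> C"
  shows "Linf_dist \<nu> A B \<le> C"
  unfolding Linf_dist_eq[OF assms(1-4)]
  by (intro ess_norm_le borel_measurable_diff Linf_measurable[OF assms(1,3)]
      Linf_measurable[OF assms(2,4)] assms(5,6))

text \<open>
  Outside one null set all the differences of representatives are bounded by the distances of their
  classes, so the representatives converge uniformly there.
\<close>

lemma mcomplete_Linf: "Metric_space.mcomplete (Linf \<nu>) (Linf_dist \<nu>)"
proof -
  interpret Metric_space "Linf \<nu>" "Linf_dist \<nu>" by (rule Metric_space_Linf)
  show ?thesis
    unfolding mcomplete_def
  proof (intro allI impI)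
    fix \<sigma> assume \<sigma>: "MCauchy \<sigma>"
    then have L: "\<sigma> n \<in> Linf \<nu>" for n by (auto simp: MCauchy_def)
    have "\<exists>f. f \<in> \<sigma> n" for n using LinfD(1)[OF L] by auto
    then obtain f where f: "\<And>n. f n \<in> \<sigma> n" by metis
    have [measurable]: "f n \<in> borel_measurable \<nu>" for n by (rule Linf_measurable[OF L f])
    define g where "g x = lim (\<lambda>n. f n x)" for x
    have gm: "g \<in> borel_measurable \<nu>" unfolding g_def by measurable
    have ae: "AE x in \<nu>. \<forall>m n. \<bar>f m x - f n x\<bar> \<le> Linf_dist \<nu> (\<sigma> m) (\<sigma> n)"
      unfolding AE_all_countable by (intro allI Linf_dist_AE L f)
    have lim: "AE x in \<nu>. (\<lambda>n. f n x) \<longlonglongrightarrow> g x"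
      using ae
    proof eventually_elim
      case (elim x)
      have "Cauchy (\<lambda>n. f n x)"
      proof (rule metric_CauchyI)
        fix e :: real assume "0 < e"
        then obtain N where "\<And>m n. N \<le> m \<Longrightarrow> N \<le> n \<Longrightarrow> Linf_dist \<nu> (\<sigma> m) (\<sigma> n) < e"
          using \<sigma> unfolding MCauchy_def by metis
        then show "\<exists>N. \<forall>m\<ge>N. \<forall>n\<ge>N. dist (f m x) (f n x) < e"
          using elim unfolding dist_real_def by (meson le_less_trans)
      qed
      then have "convergent (\<lambda>n. f n x)" by (rule Cauchy_convergent)
      then show ?case unfolding g_def convergent_LIMSEQ_iff .
    qed
    have close: "\<exists>N. \<forall>n\<ge>N. AE x in \<nu>. \<bar>f n x - g x\<bar> \<le> e" if e: "0 < e" for e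
    proof -
      obtain N where N: "\<And>m n. N \<le> m \<Longrightarrow> N \<le> n \<Longrightarrow> Linf_dist \<nu> (\<sigma> m) (\<sigma> n) < e"
        using \<sigma> e unfolding MCauchy_def by metis
      have "AE x in \<nu>. \<bar>f n x - g x\<bar> \<le> e" if n: "n \<ge> N" for n
        using ae lim
      proof eventually_elim
        case (elim x)
        have "(\<lambda>m. \<bar>f n x - f m x\<bar>) \<longlonglongrightarrow> \<bar>f n x - g x\<bar>" by (intro tendsto_intros elim)
        moreover have "\<exists>N. \<forall>m\<ge>N. \<bar>f n x - f m x\<bar> \<le> e"
          using elim(1) N[OF n] by (meson less_imp_le order_trans)
        ultimately show ?case by (rule LIMSEQ_le_const2)
      qed
      then show ?thesis by blast
    qed
    have gL: "g \<in> Linf_fun \<nu>"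
    proof -
      obtain N where N: "AE x in \<nu>. \<bar>f N x - g x\<bar> \<le> 1" using close[of 1] by auto
      have "f N \<in> Linf_fun \<nu>" using LinfD(2)[OF L] f by blast
      then obtain C where "AE x in \<nu>. \<bar>f N x\<bar> \<le> C" by (auto simp: Linf_fun_def)
      with N have "AE x in \<nu>. \<bar>g x\<bar> \<le> C + 1" by eventually_elim linarith
      then show ?thesis using gm by (auto simp: Linf_fun_def)
    qed
    show "\<exists>A. limitin mtopology \<sigma> A sequentially"
      unfolding limit_metric_sequentially
    proof (intro exI[of _ "Linf_class \<nu> g"] conjI allI impI)
      show "Linf_class \<nu> g \<in> Linf \<nu>" by (rule Linf_class_in_Linf[OF gL])
      fix e :: real assume e: "0 < e"
      then obtain N where N: "\<And>n. n \<ge> N \<Longrightarrow> AE x in \<nu>. \<bar>f n x - g x\<bar> \<le> e / 2" using close[of "e / 2"] by auto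
      have "Linf_dist \<nu> (\<sigma> n) (Linf_class \<nu> g) < e" if "n \<ge> N" for n
        using Linf_dist_le[OF L Linf_class_in_Linf[OF gL] f Linf_class_self[OF gL] N[OF that]] e by simp
      then show "\<exists>N. \<forall>n\<ge>N. \<sigma> n \<in> Linf \<nu> \<and> Linf_dist \<nu> (\<sigma> n) (Linf_class \<nu> g) < e" using L by blast
    qed
  qed
qed

section \<open>The semigroups on $L^\infty$\<close>

context markov_process
begin

lemma semigroup_op_cong_AE:
  assumes sym: "symmetric_process X P \<mu>" and \<mu>: "sets \<mu> = sets borel" and t: "0 < t"
    and f: "f \<in> borel_measurable borel" and g: "g \<in> borel_measurable borel" and ae: "AE x in \<mu>. f x = g x"
  shows "AE x in \<mu>. semigroup_op X P t f x = semigroup_op X P t g x"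
proof -
  define N where "N = {x. f x \<noteq> g x}"
  have "N \<in> sets borel" unfolding N_def using f g by measurable
  then have "N \<in> null_sets \<mu>" using ae \<mu> by (subst AE_iff_null_sets) (auto simp: N_def)
  from AE_avoids_null_set[OF sym \<mu> this t] show ?thesis
  proof eventually_elim
    case (elim x)
    have "AE \<omega> in P (Some x). extend_zero f (X (ennreal t) \<omega>) = extend_zero g (X (ennreal t) \<omega>)"
      using elim
    proof eventually_elim
      case (elim \<omega>)
      then show ?case by (cases "X (ennreal t) \<omega>") (auto simp: N_def)
    qed
    then show ?case
      unfolding semigroup_op_def expect_def
      by (intro integral_cong_AE AE_completion measurable_completion measurable_compose[OF measurable_X_P measurable_extend_zero] f g)
  qed
qed

lemma semigroup_op_add:
  assumes f: "f \<in> borel_measurable borel" "\<And>x. \<bar>f x\<bar> \<le> C" and g: "g \<in> borel_measurable borel" "\<And>x. \<bar>g x\<bar> \<le> D"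
  shows "semigroup_op X P t (\<lambda>x. f x + g x) x = semigroup_op X P t f x + semigroup_op X P t g x"
proof -
  interpret prob_space "kernel (ennreal t) (Some x)" by (rule prob_space_kernel)
  have m: "extend_zero f \<in> borel_measurable (kernel (ennreal t) (Some x))" "extend_zero g \<in> borel_measurable (kernel (ennreal t) (Some x))"
    using measurable_extend_zero[OF f(1)] measurable_extend_zero[OF g(1)] by (simp_all cong: measurable_cong_sets)
  have C: "0 \<le> C" "0 \<le> D" using f(2)[of undefined] g(2)[of undefined] by auto
  have "integrable (kernel (ennreal t) (Some x)) (extend_zero f)"
    by (rule integrable_const_bound[where B=C, OF _ m(1)])
      (simp add: abs_extend_zero_le[where f=f, OF f(2) C(1)])
  moreover have "integrable (kernel (ennreal t) (Some x)) (extend_zero g)"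
    by (rule integrable_const_bound[where B=D, OF _ m(2)])
      (simp add: abs_extend_zero_le[where f=g, OF g(2) C(2)])
  moreover have "extend_zero (\<lambda>x. f x + g x) y = extend_zero f y + extend_zero g y" for y by (cases y) auto
  ultimately show ?thesis using f g by (simp add: semigroup_op_eq_kernel)
qed

lemma semigroup_op_scale:
  assumes f: "f \<in> borel_measurable borel"
  shows "semigroup_op X P t (\<lambda>x. c * f x) x = c * semigroup_op X P t f x"
proof -
  have "extend_zero (\<lambda>x. c * f x) y = c * extend_zero f y" for y by (cases y) auto
  then show ?thesis using f by (simp add: semigroup_op_eq_kernel)
qed

text \<open>
  The operator on classes may be computed from any bounded representative.
\<close>

lemma Linf_extension_semigroup:
  assumes sym: "symmetric_process X P \<mu>" and \<mu>: "sets \<mu> = sets borel" and t: "0 < t"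
    and A: "A \<in> Linf \<mu>" and f: "f \<in> A" "\<And>x. \<bar>f x\<bar> \<le> C"
  shows "Linf_extension \<mu> (semigroup_op X P t) A = Linf_class \<mu> (semigroup_op X P t f)"
    and "semigroup_op X P t f \<in> Linf_fun \<mu>"
proof -
  have borel: "borel_measurable \<mu> = borel_measurable borel" by (rule measurable_cong_sets[OF \<mu> refl])
  have space: "space \<mu> = UNIV" using sets_eq_imp_space_eq[OF \<mu>] by simp
  have m: "h \<in> borel_measurable borel" if "h \<in> A" for h using Linf_measurable[OF A that] by (simp add: borel)
  show T: "semigroup_op X P t f \<in> Linf_fun \<mu>"
    unfolding Linf_fun_def borel
    using borel_measurable_semigroup_op[OF m[OF f(1)]] abs_semigroup_op_le[OF m[OF f(1)] f(2)]
    by (intro CollectI conjI exI[of _ C] AE_I2) auto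
  show "Linf_extension \<mu> (semigroup_op X P t) A = Linf_class \<mu> (semigroup_op X P t f)"
  proof (intro set_eqI iffI)
    fix h assume "h \<in> Linf_extension \<mu> (semigroup_op X P t) A"
    then obtain f' where h: "h \<in> Linf_fun \<mu>" "f' \<in> A" "AE x in \<mu>. h x = semigroup_op X P t f' x"
      by (auto simp: Linf_extension_def)
    have "AE x in \<mu>. semigroup_op X P t f' x = semigroup_op X P t f x"
      by (rule semigroup_op_cong_AE[OF sym \<mu> t m[OF h(2)] m[OF f(1)] LinfD(3)[OF A h(2) f(1)]])
    with h(3) have "AE x in \<mu>. h x = semigroup_op X P t f x" by eventually_elim simp
    then show "h \<in> Linf_class \<mu> (semigroup_op X P t f)" using h(1) by (simp add: mem_Linf_class[OF T])
  next
    fix h assume "h \<in> Linf_class \<mu> (semigroup_op X P t f)"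
    moreover have "bounded (f ` space \<mu>)" using f(2) by (intro boundedI[where B=C]) auto
    ultimately show "h \<in> Linf_extension \<mu> (semigroup_op X P t) A"
      using f(1) by (auto simp: Linf_extension_def mem_Linf_class[OF T])
  qed
qed

end

context metric_hunt_process
begin

text \<open>
  On $\{r < \tau_U\}$ the path is in $U$ at time $r$, and for almost every starting point it avoids the
  null set on which the two functions differ.  Since $g$ is measurable only on $U$, it is first
  replaced by $h = 1_U g$, which leaves the integrand unchanged.
\<close>

lemma part_semigroup_op_cong_AE:
  assumes sym: "symmetric_process X P \<mu>" and \<mu>: "sets \<mu> = sets borel" and r: "0 < r"
    and lc: "locally compact (UNIV :: 'a set)" and U: "open U"
    and f: "f \<in> borel_measurable borel" and g: "g \<in> borel_measurable (restrict_space \<mu> U)"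
    and ae: "AE x in restrict_space \<mu> U. g x = f x"
  shows "AE x in restrict_space \<mu> U. part_semigroup_op X P U r g x = part_semigroup_op X P U r f x"
proof -
  have borel: "borel_measurable \<mu> = borel_measurable borel" by (rule measurable_cong_sets[OF \<mu> refl])
  have space: "space \<mu> = UNIV" using sets_eq_imp_space_eq[OF \<mu>] by simp
  have Us: "U \<inter> space \<mu> \<in> sets \<mu>" using U \<mu> by (simp add: space)
  obtain L where L: "\<And>n. compact (L n)" "incseq L" "U = (\<Union>n. L n)" "U = (\<Union>n. interior (L n))"
    using compact_exhaustion[OF lc U] by metis
  define h where "h x = (if x \<in> U then g x else 0)" for x
  have h: "h \<in> borel_measurable borel"
    using g measurable_restrict_space_iff[OF Us, of 0 borel g] by (simp add: borel h_def[abs_def])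
  define N where "N = {x. x \<in> U \<and> h x \<noteq> f x}"
  have NB: "N \<in> sets borel" unfolding N_def using f h U by measurable
  have "AE x in \<mu>. x \<in> U \<longrightarrow> g x = f x" using ae by (simp add: AE_restrict_space_iff[OF Us])
  then have "AE x in \<mu>. x \<notin> N" by eventually_elim (auto simp: N_def h_def)
  then have N: "N \<in> null_sets \<mu>" using NB \<mu> by (subst AE_iff_null_sets) auto
  have alive: "X (ennreal r) \<omega> \<in> Some ` U" if "ennreal r < exit_time X U \<omega>" for \<omega>
  proof (rule ccontr)
    assume "X (ennreal r) \<omega> \<notin> Some ` U"
    then have "exit_time X U \<omega> \<le> ennreal r" unfolding exit_time_def using r by (intro Inf_lower) auto
    then show False using that by simp
  qed
  have "indicator {\<omega>. ennreal r < exit_time X U \<omega>} \<omega> * extend_zero g (X (ennreal r) \<omega>)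
    = indicator {\<omega>. ennreal r < exit_time X U \<omega>} \<omega> * extend_zero h (X (ennreal r) \<omega>)" for \<omega>
    using alive[of \<omega>] by (auto simp: indicator_def h_def)
  then have gh: "part_semigroup_op X P U r g = part_semigroup_op X P U r h"
    unfolding part_semigroup_op_def by presburger
  have "AE x in \<mu>. x \<in> U \<longrightarrow> part_semigroup_op X P U r g x = part_semigroup_op X P U r f x"
    using AE_avoids_null_set[OF sym \<mu> N r]
  proof eventually_elim
    case (elim x)
    show ?case
    proof
      assume x: "x \<in> U"
      have "AE \<omega> in P (Some x). indicator {\<omega>. ennreal r < (SUP n. exit_time X (L n) \<omega>)} \<omega> * extend_zero h (X (ennreal r) \<omega>)
        = indicator {\<omega>. ennreal r < (SUP n. exit_time X (L n) \<omega>)} \<omega> * extend_zero f (X (ennreal r) \<omega>)"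
        using elim AE_exit_time_eq_SUP[OF L x]
      proof eventually_elim
        case (elim \<omega>)
        show ?case
        proof (cases "ennreal r < exit_time X U \<omega>")
          case True
          then obtain z where z: "X (ennreal r) \<omega> = Some z" "z \<in> U" using alive[of \<omega>] by blast
          then have "h z = f z" using elim(1) by (auto simp: N_def)
          then show ?thesis by (simp add: z)
        next
          case False
          then show ?thesis using elim(2) by (simp add: indicator_def)
        qed
      qed
      then show "part_semigroup_op X P U r g x = part_semigroup_op X P U r f x"
        unfolding gh part_semigroup_op_eq(1)[OF L x h] part_semigroup_op_eq(1)[OF L x f]
        by (intro integral_cong_AE part_semigroup_op_eq(3)[OF L x] h f)
    qed
  qed
  then show ?thesis by (simp add: AE_restrict_space_iff[OF Us])
qed

lemma Linf_extension_part:
  assumes sym: "symmetric_process X P \<mu>" and \<mu>: "sets \<mu> = sets borel" and r: "0 < r"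
    and lc: "locally compact (UNIV :: 'a set)" and U: "open U"
    and f: "f \<in> borel_measurable borel" "f \<in> Linf_fun (restrict_space \<mu> U)"
    and h: "h \<in> Linf_extension (restrict_space \<mu> U) (part_semigroup_op X P U r) (Linf_class (restrict_space \<mu> U) f)"
  shows "AE x in restrict_space \<mu> U. h x = part_semigroup_op X P U r f x"
proof -
  let ?\<nu> = "restrict_space \<mu> U"
  obtain g where g: "g \<in> Linf_fun ?\<nu>" "AE x in ?\<nu>. g x = f x" "AE x in ?\<nu>. h x = part_semigroup_op X P U r g x"
    using h by (auto simp: Linf_extension_def mem_Linf_class[OF f(2)])
  have "g \<in> borel_measurable ?\<nu>" using g(1) by (simp add: Linf_fun_def)
  from part_semigroup_op_cong_AE[OF sym \<mu> r lc U f(1) this g(2)] g(3)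
  show ?thesis by eventually_elim simp
qed

text \<open>
  Total boundedness of the image of the unit ball of $L^\infty(E,\mu)$ is pulled back from
  $L^\infty(U,\mu)$: every $A$ in the ball is sent to $\phi(A) = p^U_s(p_s A)$, which lies in a totally
  bounded set, and if $\phi(A)$ and $\phi(A')$ are $\eta$-close, then $p_t A$ and $p_t A'$ are
  $3\eta$-close.
\<close>

lemma compact_operator_semigroup:
  fixes \<mu> :: "'a measure"
  assumes lc: "locally compact (UNIV :: 'a set)"
    and radon: "radon_measure \<mu>"
    and sym: "symmetric_process X P \<mu>"
    and II: "vanishes_at_boundary (resolvent_op X P 1 (\<lambda>_. 1))"
    and III: "\<And>t U. 0 < t \<Longrightarrow> open U \<Longrightarrow> emeasure \<mu> U < \<infinity> \<Longrightarrow>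
      compact_operator_Linf (restrict_space \<mu> U)
        (Linf_extension (restrict_space \<mu> U) (part_semigroup_op X P U t))"
    and t: "0 < t"
  shows "compact_operator_Linf \<mu> (Linf_extension \<mu> (semigroup_op X P t))"
proof -
  have \<mu>: "sets \<mu> = sets borel" using radon by (simp add: radon_measure_def)
  have borel: "borel_measurable \<mu> = borel_measurable borel" by (rule measurable_cong_sets[OF \<mu> refl])
  have space: "space \<mu> = UNIV" using sets_eq_imp_space_eq[OF \<mu>] by simp
  let ?T = "Linf_extension \<mu> (semigroup_op X P t)"
  note T = Linf_extension_semigroup[OF sym \<mu> t]
  interpret L: Metric_space "Linf \<mu>" "Linf_dist \<mu>" by (rule Metric_space_Linf)
  have TL: "?T A \<in> Linf \<mu>" if A: "A \<in> Linf \<mu>" for A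
  proof -
    obtain f where "f \<in> A" "\<And>x. \<bar>f x\<bar> \<le> Linf_norm \<mu> A" using Linf_bounded_representative[OF A] by metis
    from T[OF A this] show ?thesis by (simp add: Linf_class_in_Linf)
  qed
  have add: "?T (Linf_add \<mu> A B) = Linf_add \<mu> (?T A) (?T B)" if AB: "A \<in> Linf \<mu>" "B \<in> Linf \<mu>" for A B
  proof -
    obtain f where f: "f \<in> A" "f \<in> borel_measurable \<mu>" "\<And>x. \<bar>f x\<bar> \<le> Linf_norm \<mu> A"
      using Linf_bounded_representative[OF AB(1)] by metis
    obtain g where g: "g \<in> B" "g \<in> borel_measurable \<mu>" "\<And>x. \<bar>g x\<bar> \<le> Linf_norm \<mu> B"
      using Linf_bounded_representative[OF AB(2)] by metis
    have fL: "f \<in> Linf_fun \<mu>" "g \<in> Linf_fun \<mu>" using LinfD(2) AB f(1) g(1) by blast+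
    have sum: "Linf_add \<mu> A B = Linf_class \<mu> (\<lambda>x. f x + g x)"
      using Linf_add_class[OF fL] Linf_eq_class[OF AB(1) f(1)] Linf_eq_class[OF AB(2) g(1)] by simp
    have b: "\<bar>f x + g x\<bar> \<le> Linf_norm \<mu> A + Linf_norm \<mu> B" for x
      using f(3)[of x] g(3)[of x] by linarith
    have "?T (Linf_add \<mu> A B) = Linf_class \<mu> (semigroup_op X P t (\<lambda>x. f x + g x))"
      unfolding sum by (rule T(1)[OF Linf_class_in_Linf Linf_class_self b]) (use Linf_fun_add[OF fL] in auto)
    also have "semigroup_op X P t (\<lambda>x. f x + g x) = (\<lambda>x. semigroup_op X P t f x + semigroup_op X P t g x)"
      using f g by (intro ext semigroup_op_add) (auto simp: borel)
    also have "Linf_class \<mu> \<dots> = Linf_add \<mu> (?T A) (?T B)"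
      unfolding T(1)[OF AB(1) f(1,3)] T(1)[OF AB(2) g(1,3)]
      by (rule Linf_add_class[symmetric, OF T(2)[OF AB(1) f(1,3)] T(2)[OF AB(2) g(1,3)]])
    finally show ?thesis .
  qed
  have scale: "?T (Linf_scale \<mu> c A) = Linf_scale \<mu> c (?T A)" if A: "A \<in> Linf \<mu>" for c A
  proof -
    obtain f where f: "f \<in> A" "f \<in> borel_measurable \<mu>" "\<And>x. \<bar>f x\<bar> \<le> Linf_norm \<mu> A"
      using Linf_bounded_representative[OF A] by metis
    have fL: "f \<in> Linf_fun \<mu>" using LinfD(2) A f(1) by blast
    have sc: "Linf_scale \<mu> c A = Linf_class \<mu> (\<lambda>x. c * f x)"
      using Linf_scale_class[OF fL] Linf_eq_class[OF A f(1)] by simp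
    have b: "\<bar>c * f x\<bar> \<le> \<bar>c\<bar> * Linf_norm \<mu> A" for x
      using f(3)[of x] by (simp add: abs_mult mult_left_mono)
    have "?T (Linf_scale \<mu> c A) = Linf_class \<mu> (semigroup_op X P t (\<lambda>x. c * f x))"
      unfolding sc by (rule T(1)[OF Linf_class_in_Linf Linf_class_self b]) (use Linf_fun_scale[OF fL] in auto)
    also have "semigroup_op X P t (\<lambda>x. c * f x) = (\<lambda>x. c * semigroup_op X P t f x)"
      using f by (intro ext semigroup_op_scale) (auto simp: borel)
    also have "Linf_class \<mu> \<dots> = Linf_scale \<mu> c (?T A)"
      unfolding T(1)[OF A f(1,3)]
      by (rule Linf_scale_class[symmetric, OF T(2)[OF A f(1,3)]])
    finally show ?thesis .
  qed
  let ?Ball = "{A \<in> Linf \<mu>. Linf_norm \<mu> A \<le> 1}"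
  have "\<exists>f. f \<in> A \<and> f \<in> borel_measurable borel \<and> (\<forall>x. \<bar>f x\<bar> \<le> 1)" if A: "A \<in> ?Ball" for A
  proof -
    from A have "A \<in> Linf \<mu>" by simp
    then obtain f where "f \<in> A" "f \<in> borel_measurable \<mu>" "\<And>x. \<bar>f x\<bar> \<le> Linf_norm \<mu> A"
      using Linf_bounded_representative by metis
    then show ?thesis using A by (intro exI[of _ f]) (auto simp: borel intro: order_trans)
  qed
  then have "\<forall>A\<in>?Ball. \<exists>f. f \<in> A \<and> f \<in> borel_measurable borel \<and> (\<forall>x. \<bar>f x\<bar> \<le> 1)" by (rule ballI)
  from bchoice[OF this] obtain rep
    where R: "\<forall>A\<in>?Ball. rep A \<in> A \<and> rep A \<in> borel_measurable borel \<and> (\<forall>x. \<bar>rep A x\<bar> \<le> 1)" ..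
  have rep: "rep A \<in> A" "rep A \<in> borel_measurable borel" "\<bar>rep A x\<bar> \<le> 1" if "A \<in> ?Ball" for A x
    using bspec[OF R that] by simp_all
  have "L.mtotally_bounded (?T ` ?Ball)"
    unfolding L.mtotally_bounded_def
  proof (intro allI impI)
    fix \<epsilon> :: real assume \<epsilon>: "0 < \<epsilon>"
    \<comment> \<open>The total error is at most $3\eta$: one for the distance in $L^\infty(U)$ and one for each of the two approximations.\<close>
    define \<eta> where "\<eta> = \<epsilon> / 4"
    have \<eta>: "0 < \<eta>" "3 * \<eta> < \<epsilon>" using \<epsilon> by (auto simp: \<eta>_def)
    define s where "s = t / 2"
    have s: "0 < s" "t = s + s" "s / 2 \<le> t" using t by (auto simp: s_def)
    obtain K where K: "compact K" "\<And>y u. y \<notin> Some ` K \<Longrightarrow> ennreal (s / 2) \<le> u \<Longrightarrow> u < \<infinity> \<Longrightarrow> survival u y \<le> \<eta>"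
      using survival_small[OF II, of "s / 2" \<eta>] s \<eta> by auto
    obtain U where U: "open U" "K \<subseteq> U" "emeasure \<mu> U < \<infinity>"
      using compact_subset_finite_open[OF lc K(1) radon] by metis
    have Us: "U \<inter> space \<mu> \<in> sets \<mu>" using U \<mu> by (simp add: space)
    let ?\<nu> = "restrict_space \<mu> U"
    let ?S = "Linf_extension ?\<nu> (part_semigroup_op X P U s)"
    interpret LU: Metric_space "Linf ?\<nu>" "Linf_dist ?\<nu>" by (rule Metric_space_Linf)
    have comp: "compact_operator_Linf ?\<nu> ?S" by (rule III[OF s(1) U(1,3)])
    then have SL: "\<And>A. A \<in> Linf ?\<nu> \<Longrightarrow> ?S A \<in> Linf ?\<nu>" by (auto simp: compact_operator_Linf_def)
    have tb: "LU.mtotally_bounded (?S ` {A \<in> Linf ?\<nu>. Linf_norm ?\<nu> A \<le> 1})"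
      using comp SL by (intro LU.compact_closure_of_imp_mtotally_bounded) (auto simp: compact_operator_Linf_def Linf_topology_def)
    define g where "g A = semigroup_op X P s (rep A)" for A
    have g: "g A \<in> borel_measurable borel" "\<And>x. \<bar>g A x\<bar> \<le> 1" "g A \<in> Linf_fun ?\<nu>" if "A \<in> ?Ball" for A
    proof -
      show 1: "g A \<in> borel_measurable borel" unfolding g_def by (rule borel_measurable_semigroup_op[OF rep(2)[OF that]])
      show 2: "\<bar>g A x\<bar> \<le> 1" for x
        unfolding g_def by (rule abs_semigroup_op_le[OF rep(2,3)[OF that]])
      show "g A \<in> Linf_fun ?\<nu>" by (rule Linf_funI[OF _ 2]) (use 1 in \<open>simp add: measurable_restrict_space1 borel\<close>)
    qed
    define \<phi> where "\<phi> A = ?S (Linf_class ?\<nu> (g A))" for A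
    have \<phi>L: "\<phi> A \<in> Linf ?\<nu>" if "A \<in> ?Ball" for A
      unfolding \<phi>_def by (intro SL Linf_class_in_Linf g that)
    have \<phi>AE: "AE x in ?\<nu>. h x = part_semigroup_op X P U s (g A) x" if "A \<in> ?Ball" "h \<in> \<phi> A" for A h
      using that(2) unfolding \<phi>_def by (rule Linf_extension_part[OF sym \<mu> s(1) lc U(1) g(1,3)[OF that(1)]])
    have "\<phi> ` ?Ball \<subseteq> ?S ` {A \<in> Linf ?\<nu>. Linf_norm ?\<nu> A \<le> 1}"
    proof
      fix B assume "B \<in> \<phi> ` ?Ball"
      then obtain A where A: "A \<in> ?Ball" "B = \<phi> A" by auto
      have "Linf_norm ?\<nu> (Linf_class ?\<nu> (g A)) \<le> 1"
        unfolding Linf_norm_eq[OF Linf_class_in_Linf Linf_class_self, OF g(3)[OF A(1)] g(3)[OF A(1)]]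
        using g[OF A(1)] by (intro ess_norm_le) (auto simp: Linf_fun_def)
      then show "B \<in> ?S ` {A \<in> Linf ?\<nu>. Linf_norm ?\<nu> A \<le> 1}"
        unfolding A(2) \<phi>_def using g(3)[OF A(1)] by (auto intro!: imageI Linf_class_in_Linf)
    qed
    from LU.mtotally_bounded_subset[OF tb this, unfolded LU.mtotally_bounded_def, rule_format, OF \<eta>(1)]
    obtain Y where Y: "finite Y" "Y \<subseteq> \<phi> ` ?Ball" "\<phi> ` ?Ball \<subseteq> (\<Union>B\<in>Y. LU.mball B \<eta>)"
      by (elim exE conjE)
    obtain Z where Z: "Z \<subseteq> ?Ball" "finite Z" "Y = \<phi> ` Z"
      using finite_subset_image[OF Y(1,2)] by (elim exE conjE)
    have close: "Linf_dist \<mu> (?T A') (?T A) \<le> 3 * \<eta>"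
      if A: "A \<in> ?Ball" and A': "A' \<in> ?Ball" and d: "Linf_dist ?\<nu> (\<phi> A') (\<phi> A) < \<eta>" for A A'
    proof -
      have AL: "A \<in> Linf \<mu>" "A' \<in> Linf \<mu>" using A A' by auto
      obtain h h' where h: "h \<in> \<phi> A" "h' \<in> \<phi> A'" using LinfD(1) \<phi>L A A' by (metis all_not_in_conv)
      have app: "\<bar>semigroup_op X P t (rep B) x - part_semigroup_op X P U s (g B) x\<bar> \<le> \<eta>" if "B \<in> ?Ball" "x \<in> U" for B x
        unfolding g_def s(2)
        by (rule semigroup_part_semigroup_diff_le[OF lc U(1) K(1) U(2) s(1) s(1) less_imp_le[OF \<eta>(1)] K(2) rep(2,3)[OF that(1)] that(2)])
      have off: "\<bar>semigroup_op X P t (rep B) x\<bar> \<le> \<eta>" if "B \<in> ?Ball" "x \<notin> U" for B x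
      proof -
        have "\<bar>semigroup_op X P t (rep B) x\<bar> \<le> 1 * survival (ennreal t) (Some x)"
          by (rule abs_semigroup_op_le_survival[OF rep(2,3)[OF that(1)]])
        also have "\<dots> \<le> \<eta>"
          using that(2) U(2) K(2)[of "Some x" "ennreal t", OF _ ennreal_leI[OF s(3)]] by auto
        finally show ?thesis .
      qed
      have "AE x in ?\<nu>. \<bar>part_semigroup_op X P U s (g A') x - part_semigroup_op X P U s (g A) x\<bar> \<le> \<eta>"
        using \<phi>AE[OF A h(1)] \<phi>AE[OF A' h(2)] Linf_dist_AE[OF \<phi>L[OF A'] \<phi>L[OF A] h(2) h(1)]
        by eventually_elim (use d in linarith)
      then have "AE x in \<mu>. x \<in> U \<longrightarrow> \<bar>part_semigroup_op X P U s (g A') x - part_semigroup_op X P U s (g A) x\<bar> \<le> \<eta>"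
        by (simp add: AE_restrict_space_iff[OF Us])
      then have ae: "AE x in \<mu>. \<bar>semigroup_op X P t (rep A') x - semigroup_op X P t (rep A) x\<bar> \<le> 3 * \<eta>"
      proof eventually_elim
        case (elim x)
        show ?case
        proof (cases "x \<in> U")
          case True
          then show ?thesis using elim app[OF A True] app[OF A' True] by linarith
        next
          case False
          then show ?thesis using off[OF A False] off[OF A' False] \<eta> by linarith
        qed
      qed
      note TA = T[OF AL(1) rep(1,3)[OF A]] and TA' = T[OF AL(2) rep(1,3)[OF A']]
      show ?thesis
        unfolding TA(1) TA'(1)
        by (rule Linf_dist_le[OF Linf_class_in_Linf[OF TA'(2)] Linf_class_in_Linf[OF TA(2)]
            Linf_class_self[OF TA'(2)] Linf_class_self[OF TA(2)] ae]) (use \<eta> in simp)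
    qed
    have "?T ` ?Ball \<subseteq> (\<Union>B\<in>?T ` Z. L.mball B \<epsilon>)"
    proof
      fix B assume "B \<in> ?T ` ?Ball"
      then obtain A where A: "A \<in> ?Ball" "B = ?T A" by auto
      have "\<phi> A \<in> (\<Union>B\<in>\<phi> ` Z. LU.mball B \<eta>)"
        using subsetD[OF Y(3) imageI[OF A(1)]] unfolding Z(3) .
      then obtain A' where A': "A' \<in> Z" "Linf_dist ?\<nu> (\<phi> A') (\<phi> A) < \<eta>" by (auto simp: LU.in_mball)
      have "A' \<in> ?Ball" using A'(1) Z(1) by auto
      from close[OF A(1) this A'(2)] have "Linf_dist \<mu> (?T A') (?T A) < \<epsilon>" using \<eta> by linarith
      then have "B \<in> L.mball (?T A') \<epsilon>" using A \<open>A' \<in> ?Ball\<close> TL by (auto simp: L.in_mball)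
      then show "B \<in> (\<Union>B\<in>?T ` Z. L.mball B \<epsilon>)" using A'(1) by blast
    qed
    then show "\<exists>Y. finite Y \<and> Y \<subseteq> ?T ` ?Ball \<and> ?T ` ?Ball \<subseteq> (\<Union>B\<in>Y. L.mball B \<epsilon>)"
      using Z by (intro exI[of _ "?T ` Z"]) auto
  qed
  then have "compactin L.mtopology (L.mtopology closure_of (?T ` ?Ball))"
    by (simp add: L.mtotally_bounded_eq_compact_closure_of[OF mcomplete_Linf])
  then show ?thesis
    using TL add scale by (auto simp: compact_operator_Linf_def Linf_topology_def)
qed

end

theorem theorem2p2:
  fixes M :: "'w measure"
    and F :: "ennreal \<Rightarrow> 'w measure"
    and X :: "ennreal \<Rightarrow> 'w \<Rightarrow> 'a::{metric_space, second_countable_topology} option"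
    and P :: "'a option \<Rightarrow> 'w measure"
    and \<mu> :: "'a measure"
  assumes "locally compact (UNIV :: 'a set)"
    and "radon_measure \<mu>"
    and "full_support \<mu>"
    and "hunt_process M F X P"
    and "symmetric_process X P \<mu>"
    and I: "strong_Feller X P"
    and II: "vanishes_at_boundary (resolvent_op X P 1 (\<lambda>_. 1))"
    and III: "\<And>t U. 0 < t \<Longrightarrow> open U \<Longrightarrow> emeasure \<mu> U < \<infinity> \<Longrightarrow>
      compact_operator_Linf (restrict_space \<mu> U)
        (Linf_extension (restrict_space \<mu> U) (part_semigroup_op X P U t))"
  shows "\<forall>t>0. compact_operator_Linf \<mu> (Linf_extension \<mu> (semigroup_op X P t))"
proof -
  interpret metric_hunt_process M F X P
    using assms(4) by (rule metric_hunt_process.intro)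
  show ?thesis
    using compact_operator_semigroup[OF assms(1,2,5) II III] by blast
qed

end
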